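(* Let $v$ be a Krull valuation of a field $K$ with value group $G_v$ and valuation ring $R_v$ having maximal ideal $M_v$. Let $\phi(x)\in R_v[x]$ be a monic polynomial of degree $m$ which is irreducible modulo $M_v$ (that is, its image $\bar{\phi}(x)$ in $(R_v/M_v)[x]$ is irreducible). Let $f(x)\in R_v[x]$ be a polynomial not divisible by $\phi(x)$. Assume that the $\phi$-Newton polygon of $f(x)$ with respect to $v$ has $\ell\geq 1$ edges with positive slopes, these slopes being $\lambda_j$, $1\leq j\leq \ell$. For $1\leq j\leq \ell$ let $d_j$ be the smallest positive integer such that $d_j\lambda_j\in G_v$. Then for any factorization $f(x)=f_1(x)f_2(x)$ of $f(x)$ over $K$, we have $$\min\{\deg f_1(x),\deg f_2(x)\}\leq \deg f(x)-\max_{1\leq j\leq \ell}\{d_j m\}.$$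
   Context: $v$ is a Krull valuation of arbitrary rank, written additively; $G_v$ is a totally ordered abelian group, and its divisible closure carries the unique extending order. The Gaussian prolongation $v^x$ of $v$ to $K(x)$ is given on $K[x]$ by $v^x(\sum_i c_i x^i)=\min_i\{v(c_i)\}$, $c_i\in K$. $\phi$-expansion: for a monic polynomial $\phi(x)$, every $f(x)\in K[x]$ can be uniquely written as a finite sum $\sum_{i\ge 0}a_i(x)\phi(x)^i$ with $\deg a_i(x)<\deg\phi(x)$. $\phi$-Newton polygon: let $\phi(x)\in R_v[x]$ be monic with $\bar{\phi}(x)$ irreducible over $R_v/M_v$, and let $f(x)\in R_v[x]$ be not divisible by $\phi(x)$, with $\phi$-expansion $\sum_{i=0}^{n}a_i(x)\phi(x)^i$, $a_n(x)\neq 0$ (so $a_0(x)\ne 0$). For $0\le i\le n$ with $a_{n-i}(x)\neq 0$ let $P_i=(i,v^x(a_{n-i}(x)))$. For distinct such pairs $P_i,P_j$ let $$\mu_{ij}=\frac{v^x(a_{n-j}(x))-v^x(a_{n-i}(x))}{j-i},$$ an element of the divisible closure of $G_v$. Let $i_1$ be the largest index with $0<i_1\le n$ such that $\mu_{0i_1}=\min\{\mu_{0j}: 0<j\le n,\ a_{n-j}(x)\ne 0\}$. If $i_1<n$, let $i_2$ be the largest index with $i_1<i_2\le n$ such that $\mu_{i_1i_2}=\min\{\mu_{i_1j}: i_1<j\le n,\ a_{n-j}(x)\neq 0\}$. Continue in this way until an index $i_k=n$ is reached. The $\phi$-Newton polygon of $f(x)$ is then said to have $k$ edges, whose slopes are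 $\mu_{0i_1},\mu_{i_1i_2},\dots,\mu_{i_{k-1}i_k}$ (these are strictly increasing). Some of these slopes may be non-positive; the $\lambda_j$ are the slopes of those edges whose slope is positive. *)

theory Defs
  imports
    "HOL-Algebra.Polynomial_Divisibility"
    "HOL-Algebra.QuotRing"
    "HOL-Computational_Algebra.Polynomial"
begin

section \<open>The divisible closure of a totally ordered abelian group\<close>

primrec nat_mul :: "nat \<Rightarrow> 'g::comm_monoid_add \<Rightarrow> 'g" where
  "nat_mul 0 x = 0"
| "nat_mul (Suc n) x = x + nat_mul n x"

lemma nat_mul_zero_right [simp]: "nat_mul n 0 = 0"
  by (induction n) auto

lemma nat_mul_one [simp]: "nat_mul 1 x = x" "nat_mul (Suc 0) x = x"
  by auto

lemma nat_mul_add_left: "nat_mul (m + n) x = nat_mul m x + nat_mul n x"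
  by (induction m) (auto simp: ac_simps)

lemma nat_mul_add_right: "nat_mul n (x + y) = nat_mul n x + nat_mul n y"
  by (induction n) (auto simp: ac_simps)

lemma nat_mul_nat_mul: "nat_mul m (nat_mul n x) = nat_mul (m * n) x"
  by (induction m) (auto simp: nat_mul_add_left)

lemma nat_mul_minus: "nat_mul n (- x) = - nat_mul n (x :: 'g::ab_group_add)"
  by (induction n) auto

lemma nat_mul_mono: "x \<le> y \<Longrightarrow> nat_mul n x \<le> nat_mul n (y :: 'g::linordered_ab_group_add)"
  by (induction n) (auto intro: add_mono)

lemma nat_mul_strict_mono:
  "n > 0 \<Longrightarrow> x < y \<Longrightarrow> nat_mul n x < nat_mul n (y :: 'g::linordered_ab_group_add)"
proof (induction n)
  case (Suc n)
  then show ?case by (cases n) (auto intro: add_strict_mono)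
qed auto

lemma nat_mul_le_iff:
  "n > 0 \<Longrightarrow> nat_mul n x \<le> nat_mul n y \<longleftrightarrow> x \<le> (y :: 'g::linordered_ab_group_add)"
  by (meson nat_mul_mono nat_mul_strict_mono not_le)

lemma nat_mul_eq_iff:
  "n > 0 \<Longrightarrow> nat_mul n x = nat_mul n y \<longleftrightarrow> x = (y :: 'g::linordered_ab_group_add)"
  by (metis nat_mul_strict_mono neq_iff)

text \<open>
  A pair \<open>(a, m)\<close> with \<open>m > 0\<close> stands for the fraction \<open>a / m\<close>.
\<close>

definition fracrel :: "('g::linordered_ab_group_add \<times> nat) \<Rightarrow> ('g \<times> nat) \<Rightarrow> bool" where
  "fracrel p q \<longleftrightarrow> snd p > 0 \<and> snd q > 0 \<and> nat_mul (snd q) (fst p) = nat_mul (snd p) (fst q)"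

lemma fracrel_trans:
  assumes "fracrel p q" "fracrel q r"
  shows "fracrel p r"
proof -
  have "nat_mul (snd q) (nat_mul (snd r) (fst p)) = nat_mul (snd r) (nat_mul (snd q) (fst p))"
    by (simp add: nat_mul_nat_mul mult.commute)
  also have "\<dots> = nat_mul (snd r) (nat_mul (snd p) (fst q))"
    using assms by (simp add: fracrel_def)
  also have "\<dots> = nat_mul (snd p) (nat_mul (snd r) (fst q))"
    by (simp add: nat_mul_nat_mul mult.commute)
  also have "\<dots> = nat_mul (snd p) (nat_mul (snd q) (fst r))"
    using assms by (simp add: fracrel_def)
  also have "\<dots> = nat_mul (snd q) (nat_mul (snd p) (fst r))"
    by (simp add: nat_mul_nat_mul mult.commute)
  finally show ?thesis
    using assms by (simp add: fracrel_def nat_mul_eq_iff)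
qed

lemma part_equivp_fracrel: "part_equivp fracrel"
proof (rule part_equivpI)
  show "\<exists>p. fracrel p (p :: 'g::linordered_ab_group_add \<times> nat)"
    by (rule exI[of _ "(0, 1)"]) (simp add: fracrel_def)
  show "symp fracrel"
    by (auto simp: symp_def fracrel_def)
  show "transp fracrel"
    by (blast intro: transpI fracrel_trans)
qed

quotient_type (overloaded) 'g div_closure =
  "'g::linordered_ab_group_add \<times> nat" / partial: fracrel
  by (rule part_equivp_fracrel)

text \<open>\<open>group_frac a n\<close> is the element \<open>a / n\<close>; as with \<open>Fract\<close>, it is zero when \<open>n = 0\<close>.\<close>

lift_definition group_frac :: "'g::linordered_ab_group_add \<Rightarrow> nat \<Rightarrow> 'g div_closure"
  is "\<lambda>a n. if n = 0 then (0, 1) else (a, n)"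
  by (simp add: fracrel_def)

lemma group_frac_cases [cases type: div_closure]:
  obtains a n where "n > 0" "q = group_frac a n"
  by transfer (auto simp: fracrel_def)

lemma group_frac_eq_iff:
  "m > 0 \<Longrightarrow> n > 0 \<Longrightarrow> group_frac a m = group_frac b n \<longleftrightarrow> nat_mul n a = nat_mul m b"
  by transfer (auto simp: fracrel_def)

instantiation div_closure :: (linordered_ab_group_add) linordered_ab_group_add
begin

lift_definition zero_div_closure :: "'a div_closure" is "(0, 1)"
  by (simp add: fracrel_def)

lift_definition plus_div_closure :: "'a div_closure \<Rightarrow> 'a div_closure \<Rightarrow> 'a div_closure"
  is "\<lambda>p q. (nat_mul (snd q) (fst p) + nat_mul (snd p) (fst q), snd p * snd q)"
  subgoal premises prems for p p' q q'
  proof -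
    have "nat_mul (snd p' * snd q') (nat_mul (snd q) (fst p))
        = nat_mul (snd q * snd q') (nat_mul (snd p') (fst p))"
      by (simp add: nat_mul_nat_mul ac_simps)
    also have "\<dots> = nat_mul (snd p * snd q) (nat_mul (snd q') (fst p'))"
      using prems by (simp add: fracrel_def nat_mul_nat_mul ac_simps)
    finally have 1: "nat_mul (snd p' * snd q') (nat_mul (snd q) (fst p))
        = nat_mul (snd p * snd q) (nat_mul (snd q') (fst p'))" .
    have "nat_mul (snd p' * snd q') (nat_mul (snd p) (fst q))
        = nat_mul (snd p * snd p') (nat_mul (snd q') (fst q))"
      by (simp add: nat_mul_nat_mul ac_simps)
    also have "\<dots> = nat_mul (snd p * snd q) (nat_mul (snd p') (fst q'))"
      using prems by (simp add: fracrel_def nat_mul_nat_mul ac_simps)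
    finally show ?thesis
      using 1 prems by (simp add: fracrel_def nat_mul_add_right)
  qed
  done

lift_definition uminus_div_closure :: "'a div_closure \<Rightarrow> 'a div_closure"
  is "\<lambda>p. (- fst p, snd p)"
  by (simp add: fracrel_def nat_mul_minus)

definition minus_div_closure :: "'a div_closure \<Rightarrow> 'a div_closure \<Rightarrow> 'a div_closure" where
  "minus_div_closure p q = p + - q"

lift_definition less_eq_div_closure :: "'a div_closure \<Rightarrow> 'a div_closure \<Rightarrow> bool"
  is "\<lambda>p q. nat_mul (snd q) (fst p) \<le> nat_mul (snd p) (fst q)"
  subgoal premises prems for p p' q q'
  proof -
    have pos: "snd p > 0" "snd p' > 0" "snd q > 0" "snd q' > 0"
      using prems by (auto simp: fracrel_def)
    have 1: "nat_mul (snd p' * snd q') (nat_mul (snd q) (fst p))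
        = nat_mul (snd p * snd q) (nat_mul (snd q') (fst p'))"
    proof -
      have "nat_mul (snd p' * snd q') (nat_mul (snd q) (fst p))
          = nat_mul (snd q * snd q') (nat_mul (snd p') (fst p))"
        by (simp add: nat_mul_nat_mul ac_simps)
      also have "\<dots> = nat_mul (snd p * snd q) (nat_mul (snd q') (fst p'))"
        using prems by (simp add: fracrel_def nat_mul_nat_mul ac_simps)
      finally show ?thesis .
    qed
    have 2: "nat_mul (snd p' * snd q') (nat_mul (snd p) (fst q))
        = nat_mul (snd p * snd q) (nat_mul (snd p') (fst q'))"
    proof -
      have "nat_mul (snd p' * snd q') (nat_mul (snd p) (fst q))
          = nat_mul (snd p * snd p') (nat_mul (snd q') (fst q))"
        by (simp add: nat_mul_nat_mul ac_simps)
      also have "\<dots> = nat_mul (snd p * snd q) (nat_mul (snd p') (fst q'))"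
        using prems by (simp add: fracrel_def nat_mul_nat_mul ac_simps)
      finally show ?thesis .
    qed
    have "nat_mul (snd q) (fst p) \<le> nat_mul (snd p) (fst q) \<longleftrightarrow>
        nat_mul (snd p' * snd q') (nat_mul (snd q) (fst p))
        \<le> nat_mul (snd p' * snd q') (nat_mul (snd p) (fst q))"
      using pos by (simp add: nat_mul_le_iff)
    also have "\<dots> \<longleftrightarrow> nat_mul (snd q') (fst p') \<le> nat_mul (snd p') (fst q')"
      unfolding 1 2 using pos by (simp add: nat_mul_le_iff)
    finally show ?thesis .
  qed
  done

definition less_div_closure :: "'a div_closure \<Rightarrow> 'a div_closure \<Rightarrow> bool" where
  "less_div_closure p q \<longleftrightarrow> p \<le> q \<and> \<not> q \<le> p"

lemma group_frac_zero: "0 = group_frac (0 :: 'a) 1"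
  by transfer (simp add: fracrel_def)

lemma group_frac_add:
  "m > 0 \<Longrightarrow> n > 0 \<Longrightarrow> group_frac a m + group_frac b n =
    group_frac (nat_mul n a + nat_mul m (b :: 'a)) (m * n)"
  by transfer (auto simp: fracrel_def)

lemma group_frac_uminus: "n > 0 \<Longrightarrow> - group_frac a n = group_frac (- a :: 'a) n"
  by transfer (auto simp: fracrel_def)

lemma group_frac_le_iff:
  "m > 0 \<Longrightarrow> n > 0 \<Longrightarrow> group_frac a m \<le> group_frac b n \<longleftrightarrow> nat_mul n a \<le> nat_mul m (b :: 'a)"
  by transfer auto

instance
proof
  fix p q r :: "'a div_closure"
  obtain a m where p: "p = group_frac a m" "m > 0" by (cases p)
  obtain b n where q: "q = group_frac b n" "n > 0" by (cases q)
  obtain c k where r: "r = group_frac c k" "k > 0" by (cases r)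
  show "p + q + r = p + (q + r)"
    using p q r by (simp add: group_frac_add nat_mul_add_right nat_mul_nat_mul ac_simps)
  show "p + q = q + p"
    using p q by (simp add: group_frac_add ac_simps)
  show "0 + p = p"
    using p by (simp add: group_frac_zero group_frac_add group_frac_eq_iff)
  show "- p + p = 0"
    using p
    by (simp add: group_frac_zero group_frac_add group_frac_uminus group_frac_eq_iff nat_mul_minus)
  show "p - q = p + - q"
    by (rule minus_div_closure_def)
  show "p < q \<longleftrightarrow> p \<le> q \<and> \<not> q \<le> p"
    by (rule less_div_closure_def)
  show "p \<le> p"
    using p by (simp add: group_frac_le_iff)
  show "p \<le> q \<Longrightarrow> q \<le> p \<Longrightarrow> p = q"
    using p q by (simp add: group_frac_le_iff group_frac_eq_iff)
  show "p \<le> q \<or> q \<le> p"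
    using p q by (simp add: group_frac_le_iff linear)
  show "p \<le> r" if "p \<le> q" "q \<le> r"
  proof -
    have "nat_mul n (nat_mul k a) = nat_mul k (nat_mul n a)"
      by (simp add: nat_mul_nat_mul mult.commute)
    also have "\<dots> \<le> nat_mul k (nat_mul m b)"
      using that p q by (simp add: group_frac_le_iff nat_mul_mono)
    also have "\<dots> = nat_mul m (nat_mul k b)"
      by (simp add: nat_mul_nat_mul mult.commute)
    also have "\<dots> \<le> nat_mul m (nat_mul n c)"
      using that q r by (simp add: group_frac_le_iff nat_mul_mono)
    also have "\<dots> = nat_mul n (nat_mul m c)"
      by (simp add: nat_mul_nat_mul mult.commute)
    finally show ?thesis
      using p q r by (simp add: group_frac_le_iff nat_mul_le_iff)
  qed
  show "r + p \<le> r + q" if "p \<le> q"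
  proof -
    have "nat_mul (k * k) (nat_mul n a) \<le> nat_mul (k * k) (nat_mul m b)"
      using that p q by (simp add: group_frac_le_iff nat_mul_mono)
    then show ?thesis
      using p q r
      by (simp add: group_frac_add group_frac_le_iff nat_mul_add_right nat_mul_nat_mul ac_simps)
  qed
qed

end

definition of_group :: "'g::linordered_ab_group_add \<Rightarrow> 'g div_closure" where
  "of_group g = group_frac g 1"

lemma of_group_le_iff: "of_group a \<le> of_group b \<longleftrightarrow> a \<le> b"
  by (simp add: of_group_def group_frac_le_iff)

lemma of_group_eq_iff: "of_group a = of_group b \<longleftrightarrow> a = b"
  by (simp add: of_group_def group_frac_eq_iff)

lemma of_group_add: "of_group (a + b) = of_group a + of_group b"
  by (simp add: of_group_def group_frac_add)

lemma nat_mul_group_frac: "n > 0 \<Longrightarrow> nat_mul k (group_frac a n) = group_frac (nat_mul k a) n"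
  by (induction k)
    (auto simp: group_frac_zero group_frac_add group_frac_eq_iff nat_mul_add_right nat_mul_nat_mul ac_simps)

lemma nat_mul_group_frac_cancel: "n > 0 \<Longrightarrow> nat_mul n (group_frac a n) = of_group a"
  by (simp add: nat_mul_group_frac of_group_def group_frac_eq_iff)

lemma div_closure_divisible:
  assumes "n > 0"
  shows "\<exists>y. nat_mul n y = (x :: 'g::linordered_ab_group_add div_closure)"
proof -
  obtain a m where "m > 0" "x = group_frac a m" by (cases x)
  then have "nat_mul n (group_frac a (n * m)) = x"
    using assms by (simp add: nat_mul_group_frac group_frac_eq_iff nat_mul_nat_mul ac_simps)
  then show ?thesis by blast
qed

lemma div_closure_torsion_over:
  "\<exists>n>0. nat_mul n (x :: 'g::linordered_ab_group_add div_closure) \<in> range of_group"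
  by (cases x) (metis nat_mul_group_frac_cancel rangeI)


section \<open>Krull valuations\<close>

text \<open>
  The group \<open>'g\<close> may be larger than the value group.  The convention \<open>v 0 = \<infinity>\<close> is expressed by
  never using the value of \<open>v\<close> at \<open>0\<close>.
\<close>

definition krull_valuation :: "('a::field \<Rightarrow> 'g::linordered_ab_group_add) \<Rightarrow> bool" where
  "krull_valuation v \<longleftrightarrow>
     (\<forall>x y. x \<noteq> 0 \<longrightarrow> y \<noteq> 0 \<longrightarrow> v (x * y) = v x + v y) \<and>
     (\<forall>x y. x \<noteq> 0 \<longrightarrow> y \<noteq> 0 \<longrightarrow> x + y \<noteq> 0 \<longrightarrow> min (v x) (v y) \<le> v (x + y))"

definition value_group :: "('a::field \<Rightarrow> 'g::linordered_ab_group_add) \<Rightarrow> 'g set" where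
  "value_group v = v ` (UNIV - {0})"

definition valuation_ring_set :: "('a::field \<Rightarrow> 'g::linordered_ab_group_add) \<Rightarrow> 'a set" where
  "valuation_ring_set v = {x. x = 0 \<or> 0 \<le> v x}"

definition maximal_ideal :: "('a::field \<Rightarrow> 'g::linordered_ab_group_add) \<Rightarrow> 'a set" where
  "maximal_ideal v = {x. x = 0 \<or> 0 < v x}"

definition valuation_ring :: "('a::field \<Rightarrow> 'g::linordered_ab_group_add) \<Rightarrow> 'a ring" where
  "valuation_ring v =
     \<lparr>carrier = valuation_ring_set v, monoid.mult = (*), one = 1, ring.zero = 0, add = (+)\<rparr>"

definition residue_field :: "('a::field \<Rightarrow> 'g::linordered_ab_group_add) \<Rightarrow> 'a set ring" where
  "residue_field v = valuation_ring v Quot maximal_ideal v"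

definition integral_polys :: "('a::field \<Rightarrow> 'g::linordered_ab_group_add) \<Rightarrow> 'a poly set" where
  "integral_polys v = {p. \<forall>i. Polynomial.coeff p i \<in> valuation_ring_set v}"

text \<open>
  Polynomials over the residue field are those of \<^theory>\<open>HOL-Algebra.Polynomials\<close>: lists of
  coefficients, leading coefficient first and nonzero.
\<close>

definition reduce_poly ::
  "('a::field \<Rightarrow> 'g::linordered_ab_group_add) \<Rightarrow> 'a poly \<Rightarrow> 'a set list" where
  "reduce_poly v p = ring.normalize (residue_field v)
     (map (\<lambda>c. maximal_ideal v +>\<^bsub>valuation_ring v\<^esub> c) (rev (Polynomial.coeffs p)))"

definition irreducible_mod :: "('a::field \<Rightarrow> 'g::linordered_ab_group_add) \<Rightarrow> 'a poly \<Rightarrow> bool" where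
  "irreducible_mod v p \<longleftrightarrow>
     pirreducible\<^bsub>residue_field v\<^esub> (carrier (residue_field v)) (reduce_poly v p)"

text \<open>The Gaussian prolongation, on nonzero polynomials.\<close>

definition gauss :: "('a::field \<Rightarrow> 'g::linordered_ab_group_add) \<Rightarrow> 'a poly \<Rightarrow> 'g" where
  "gauss v p = Min {v (Polynomial.coeff p i) | i. Polynomial.coeff p i \<noteq> 0}"


section \<open>Expansions in powers of a polynomial\<close>

definition is_expansion :: "'a::field poly \<Rightarrow> 'a poly \<Rightarrow> (nat \<Rightarrow> 'a poly) \<Rightarrow> bool" where
  "is_expansion \<phi> f a \<longleftrightarrow>
     (\<forall>i. a i \<noteq> 0 \<longrightarrow> Polynomial.degree (a i) < Polynomial.degree \<phi>) \<and>
     (\<exists>n. (\<forall>i>n. a i = 0) \<and> f = (\<Sum>i\<le>n. a i * \<phi> ^ i))"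

definition expansion :: "'a::field poly \<Rightarrow> 'a poly \<Rightarrow> nat \<Rightarrow> 'a poly" where
  "expansion \<phi> f = (THE a. is_expansion \<phi> f a)"

definition expansion_length :: "'a::field poly \<Rightarrow> 'a poly \<Rightarrow> nat" where
  "expansion_length \<phi> f = Max {i. expansion \<phi> f i \<noteq> 0}"

lemma is_expansion_coeff:
  assumes "is_expansion \<phi> f a" "Polynomial.degree \<phi> > 0"
  shows "a i = f div \<phi> ^ i mod \<phi>"
proof -
  have "f = (\<Sum>i\<le>n. a i * \<phi> ^ i) \<Longrightarrow> \<forall>i>n. a i = 0 \<Longrightarrow>
      \<forall>i. a i \<noteq> 0 \<longrightarrow> Polynomial.degree (a i) < Polynomial.degree \<phi> \<Longrightarrow>
      a i = f div \<phi> ^ i mod \<phi>" for n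
  proof (induction n arbitrary: f a i)
    case 0
    have *: "f mod \<phi> = a 0" "f div \<phi> = 0"
      using 0 assms(2) by (auto intro: mod_poly_less div_poly_less)
        (cases "a 0 = 0"; auto intro: mod_poly_less div_poly_less)+
    show ?case
    proof (cases i)
      case (Suc j)
      then show ?thesis
        using 0 * by (simp add: poly_div_mult_right)
    qed (use * in auto)
  next
    case (Suc n)
    define g where "g = (\<Sum>i\<le>n. a (Suc i) * \<phi> ^ i)"
    have "f = a 0 + \<phi> * g"
      unfolding g_def Suc.prems(1)
      by (subst sum.atMost_Suc_shift) (simp add: sum_distrib_left ac_simps)
    moreover have "a 0 mod \<phi> = a 0" "a 0 div \<phi> = 0"
      using Suc.prems(3) by (cases "a 0 = 0"; auto intro: mod_poly_less div_poly_less)+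
    moreover have "\<phi> \<noteq> 0"
      using assms(2) by auto
    ultimately have *: "f mod \<phi> = a 0" "f div \<phi> = g"
      by (simp_all add: poly_div_add_left)
    show ?case
    proof (cases i)
      case (Suc j)
      have "a (Suc j) = g div \<phi> ^ j mod \<phi>"
        using Suc.prems by (intro Suc.IH[where a = "\<lambda>i. a (Suc i)"]) (auto simp: g_def)
      then show ?thesis
        using Suc * by (simp add: poly_div_mult_right)
    qed (use * in auto)
  qed
  then show ?thesis
    using assms(1) unfolding is_expansion_def by blast
qed

lemma ex_is_expansion:
  assumes "Polynomial.degree \<phi> > 0"
  shows "\<exists>a. is_expansion \<phi> f a"
proof (induction "Polynomial.degree f" arbitrary: f rule: less_induct)
  case less
  show ?case
  proof (cases "Polynomial.degree f < Polynomial.degree \<phi>")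
    case True
    then have "is_expansion \<phi> f (\<lambda>i. if i = 0 then f else 0)"
      by (auto simp: is_expansion_def intro!: exI[of _ 0])
    then show ?thesis by blast
  next
    case False
    have "Polynomial.degree (f div \<phi>) < Polynomial.degree f"
      using False assms by (simp add: degree_div_less)
    then obtain a where a: "is_expansion \<phi> (f div \<phi>) a"
      using less by blast
    then obtain n where n: "\<forall>i>n. a i = 0" "f div \<phi> = (\<Sum>i\<le>n. a i * \<phi> ^ i)"
      by (auto simp: is_expansion_def)
    define b where "b = case_nat (f mod \<phi>) a"
    have "f = f mod \<phi> + \<phi> * (f div \<phi>)"
      by simp
    also have "\<dots> = (\<Sum>i\<le>Suc n. b i * \<phi> ^ i)"
      unfolding n(2)
      by (subst sum.atMost_Suc_shift) (simp add: b_def sum_distrib_left ac_simps)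
    finally have "f = (\<Sum>i\<le>Suc n. b i * \<phi> ^ i)" .
    moreover have "\<forall>i>Suc n. b i = 0"
      using n(1) by (auto simp: b_def split: nat.splits)
    moreover have "b i \<noteq> 0 \<longrightarrow> Polynomial.degree (b i) < Polynomial.degree \<phi>" for i
      using a assms degree_mod_less[of \<phi> f]
      by (cases i; cases "\<phi> = 0") (auto simp: b_def is_expansion_def)
    ultimately show ?thesis
      unfolding is_expansion_def by blast
  qed
qed

lemma is_expansion_expansion:
  assumes "Polynomial.degree \<phi> > 0"
  shows "is_expansion \<phi> f (expansion \<phi> f)"
proof -
  have "\<exists>!a. is_expansion \<phi> f a"
    using ex_is_expansion[OF assms] is_expansion_coeff[OF _ assms] by (metis ext)
  then show ?thesis
    unfolding expansion_def by (rule theI')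
qed


section \<open>Newton polygons\<close>

text \<open>
  The polygon is built from the points \<open>(i, y i)\<close> for \<open>i \<in> S\<close>.
\<close>

definition slope :: "(nat \<Rightarrow> 'g::linordered_ab_group_add) \<Rightarrow> nat \<Rightarrow> nat \<Rightarrow> 'g div_closure" where
  "slope y i j = group_frac (y j - y i) (j - i)"

definition next_vertex :: "nat set \<Rightarrow> (nat \<Rightarrow> 'g::linordered_ab_group_add) \<Rightarrow> nat \<Rightarrow> nat" where
  "next_vertex S y i =
     Max {j \<in> S. i < j \<and> slope y i j = Min {slope y i k | k. k \<in> S \<and> i < k}}"

lemma next_vertex_in:
  assumes "finite S" "\<exists>j\<in>S. i < j"
  shows "next_vertex S y i \<in> S" "i < next_vertex S y i"
proof -
  let ?A = "{slope y i k | k. k \<in> S \<and> i < k}"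
  let ?J = "{j \<in> S. i < j \<and> slope y i j = Min ?A}"
  have "Min ?A \<in> ?A"
    using assms by (intro Min_in) auto
  then have "?J \<noteq> {}" by force
  then have "Max ?J \<in> ?J"
    using assms(1) by (intro Max_in) auto
  then show "next_vertex S y i \<in> S" "i < next_vertex S y i"
    by (auto simp: next_vertex_def)
qed

text \<open>The slopes of the edges to the right of the vertex with index \<open>i\<close>, from left to right.\<close>

function slopes_from ::
  "nat set \<Rightarrow> (nat \<Rightarrow> 'g::linordered_ab_group_add) \<Rightarrow> nat \<Rightarrow> 'g div_closure list" where
  "slopes_from S y i =
     (if finite S \<and> (\<exists>j\<in>S. i < j)
      then slope y i (next_vertex S y i) # slopes_from S y (next_vertex S y i)
      else [])"
  by auto
termination
proof (relation "measure (\<lambda>(S, y, i). Max S - i)")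
  fix S :: "nat set" and y :: "nat \<Rightarrow> 'g::linordered_ab_group_add" and i
  assume "finite S \<and> (\<exists>j\<in>S. i < j)"
  then have "i < next_vertex S y i" "next_vertex S y i \<le> Max S"
    by (auto simp: next_vertex_in)
  then show "((S, y, next_vertex S y i), (S, y, i)) \<in> measure (\<lambda>(S, y, i). Max S - i)"
    by simp
qed simp

declare slopes_from.simps [simp del]

text \<open>
  If \<open>\<phi>\<close> does not divide \<open>f\<close>, then the last point has index \<open>expansion_length \<phi> f\<close>.
\<close>

definition newton_slopes ::
  "('a::field \<Rightarrow> 'g::linordered_ab_group_add) \<Rightarrow> 'a poly \<Rightarrow> 'a poly \<Rightarrow> 'g div_closure list" where
  "newton_slopes v \<phi> f =
     (let a = expansion \<phi> f; n = expansion_length \<phi> f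
      in slopes_from {i. i \<le> n \<and> a (n - i) \<noteq> 0} (\<lambda>i. gauss v (a (n - i))) 0)"

definition positive_slopes ::
  "('a::field \<Rightarrow> 'g::linordered_ab_group_add) \<Rightarrow> 'a poly \<Rightarrow> 'a poly \<Rightarrow> 'g div_closure list" where
  "positive_slopes v \<phi> f = filter (\<lambda>s. 0 < s) (newton_slopes v \<phi> f)"

definition slope_denominator ::
  "('a::field \<Rightarrow> 'g::linordered_ab_group_add) \<Rightarrow> 'g div_closure \<Rightarrow> nat" where
  "slope_denominator v s = (LEAST d. 0 < d \<and> nat_mul d s \<in> of_group ` value_group v)"

end

theory Submission
  imports Defs
begin

text \<open>
  Fix a positive slope \<open>\<mu>\<close> of the polygon of \<open>f\<close>, and give the term \<open>a\<^sub>i \<phi>\<^sup>i\<close> of a \<open>\<phi>\<close>-expansion the value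
  \<open>v\<^sup>x(a\<^sub>i) + i \<mu>\<close>.  Call an index supporting if its term has the least value.  Geometrically, the
  supporting indices are those of the points on the line of slope \<open>\<mu>\<close> that bounds the polygon from
  below.  An edge of slope \<open>\<mu>\<close> lies on this line, so \<open>f\<close> has at least two supporting indices
  (\<open>slopes_from_supporting\<close>, \<open>newton_slope_supporting\<close>).

  If \<open>f\<^sub>1\<close> and \<open>f\<^sub>2\<close> each had a single supporting index, \<open>s\<close> and \<open>t\<close>, then \<open>s + t\<close> would be the only
  supporting index of \<open>f\<^sub>1 f\<^sub>2\<close> (\<open>supporting_indices_mult_singleton\<close>).  Indeed the \<open>\<phi>\<close>-expansion of the
  product comes from the products \<open>a\<^sub>i b\<^sub>j\<close>, which are divided by \<open>\<phi>\<close> with the quotient carried to the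
  next power.  A carry has strictly greater value because it moves one place up and \<open>\<mu> > 0\<close>, and every
  \<open>a\<^sub>i b\<^sub>j\<close> with \<open>(i, j) \<noteq> (s, t)\<close> also has strictly greater value.  What remains is the remainder of
  \<open>a\<^sub>s b\<^sub>t\<close>, whose value has not increased: after scaling to primitive polynomials, both factors have
  nonzero reductions of degree below that of the irreducible polynomial \<open>\<phi>\<close> modulo \<open>M\<^sub>v\<close>, so their
  product is not divisible by it (\<open>irreducible_mod_prime\<close>, \<open>gauss_mult_mod\<close>).

  Hence one factor \<open>h\<close> has two supporting indices \<open>i < j\<close>.  Equality of the two values shows that
  \<open>(j - i) \<mu>\<close> is a difference of values of \<open>v\<close>, so \<open>j - i\<close> is at least the denominator \<open>d\<close> of \<open>\<mu>\<close>.
  Since \<open>\<phi>\<^sup>j\<close> occurs in the expansion of \<open>h\<close>, \<open>deg h \<ge> j m \<ge> d m\<close> (\<open>factor_degree_ge\<close>), and the other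
  factor has degree at most \<open>deg f - d m\<close>.
\<close>

section \<open>The filtration of a field by a Krull valuation\<close>

lemma krull_valuationD:
  assumes "krull_valuation v"
  shows krull_valuation_mult: "x \<noteq> 0 \<Longrightarrow> y \<noteq> 0 \<Longrightarrow> v (x * y) = v x + v y"
    and krull_valuation_add: "x \<noteq> 0 \<Longrightarrow> y \<noteq> 0 \<Longrightarrow> x + y \<noteq> 0 \<Longrightarrow> min (v x) (v y) \<le> v (x + y)"
  using assms unfolding krull_valuation_def by auto

text \<open>
  The element \<open>0\<close> has value infinity, so it belongs to every step of the filtration.
\<close>

definition val_ge :: "('a::field \<Rightarrow> 'g::linordered_ab_group_add) \<Rightarrow> 'g \<Rightarrow> 'a set" where
  "val_ge v g = {c. c = 0 \<or> g \<le> v c}"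

definition val_gt :: "('a::field \<Rightarrow> 'g::linordered_ab_group_add) \<Rightarrow> 'g \<Rightarrow> 'a set" where
  "val_gt v g = {c. c = 0 \<or> g < v c}"

definition polys_over :: "'a::zero set \<Rightarrow> 'a poly set" where
  "polys_over S = {p. \<forall>i. Polynomial.coeff p i \<in> S}"

locale krull_valued =
  fixes v :: "'a::field \<Rightarrow> 'g::linordered_ab_group_add"
  assumes krull: "krull_valuation v"
begin

lemma val_mult: "x \<noteq> 0 \<Longrightarrow> y \<noteq> 0 \<Longrightarrow> v (x * y) = v x + v y"
  using krull by (rule krull_valuation_mult)

lemma val_one [simp]: "v 1 = 0"
  using val_mult[of 1 1] by simp

lemma val_uminus [simp]: "v (- x) = v x"
proof (cases "x = 0")
  case False
  have "v (-1) + v (-1) = 0"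
    using val_mult[of "-1" "-1"] by simp
  then have "v (-1) = 0" by simp
  then show ?thesis
    using val_mult[of "-1" x] False by simp
qed simp

lemma val_inverse: "x \<noteq> 0 \<Longrightarrow> v (inverse x) = - v x"
  using val_mult[of x "inverse x"] by (simp add: eq_neg_iff_add_eq_0 add.commute)

lemma zero_in_val_ge [simp]: "0 \<in> val_ge v g" and zero_in_val_gt [simp]: "0 \<in> val_gt v g"
  by (simp_all add: val_ge_def val_gt_def)

lemma val_ge_add: "x \<in> val_ge v g \<Longrightarrow> y \<in> val_ge v g \<Longrightarrow> x + y \<in> val_ge v g"
  unfolding val_ge_def
  using krull_valuation_add[OF krull, of x y] by (cases "x = 0 \<or> y = 0 \<or> x + y = 0") (auto simp: min_def split: if_splits)

lemma val_gt_add: "x \<in> val_gt v g \<Longrightarrow> y \<in> val_gt v g \<Longrightarrow> x + y \<in> val_gt v g"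
  unfolding val_gt_def
  using krull_valuation_add[OF krull, of x y] by (cases "x = 0 \<or> y = 0 \<or> x + y = 0") (auto simp: min_def split: if_splits)

lemma val_ge_mult: "x \<in> val_ge v g \<Longrightarrow> y \<in> val_ge v h \<Longrightarrow> x * y \<in> val_ge v (g + h)"
  unfolding val_ge_def by (cases "x = 0 \<or> y = 0") (auto simp: val_mult add_mono)

lemma val_gt_mult_left: "x \<in> val_gt v g \<Longrightarrow> y \<in> val_ge v h \<Longrightarrow> x * y \<in> val_gt v (g + h)"
  unfolding val_ge_def val_gt_def by (cases "x = 0 \<or> y = 0") (auto simp: val_mult add_less_le_mono)

lemma val_gt_mult_right: "x \<in> val_ge v g \<Longrightarrow> y \<in> val_gt v h \<Longrightarrow> x * y \<in> val_gt v (g + h)"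
  unfolding val_ge_def val_gt_def by (cases "x = 0 \<or> y = 0") (auto simp: val_mult add_le_less_mono)

lemma sum_in_val_ge: "(\<And>i. i \<in> A \<Longrightarrow> f i \<in> val_ge v g) \<Longrightarrow> sum f A \<in> val_ge v g"
  by (induction A rule: infinite_finite_induct) (auto intro: val_ge_add)

lemma sum_in_val_gt: "(\<And>i. i \<in> A \<Longrightarrow> f i \<in> val_gt v g) \<Longrightarrow> sum f A \<in> val_gt v g"
  by (induction A rule: infinite_finite_induct) (auto intro: val_gt_add)

lemma val_gt_subset_val_ge: "val_gt v g \<subseteq> val_ge v g"
  by (auto simp: val_gt_def val_ge_def)

lemma val_ge_smult: "r \<in> valuation_ring_set v \<Longrightarrow> x \<in> val_ge v g \<Longrightarrow> r * x \<in> val_ge v g"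
  and val_gt_smult: "r \<in> valuation_ring_set v \<Longrightarrow> x \<in> val_gt v g \<Longrightarrow> r * x \<in> val_gt v g"
  using val_ge_mult[of r 0 x g] val_gt_mult_right[of r 0 x g]
  by (auto simp: valuation_ring_set_def val_ge_def)

lemma valuation_ring_set_eq: "valuation_ring_set v = val_ge v 0"
  and maximal_ideal_eq: "maximal_ideal v = val_gt v 0"
  and integral_polys_eq: "integral_polys v = polys_over (val_ge v 0)"
  by (simp_all add: valuation_ring_set_def maximal_ideal_def integral_polys_def
      val_ge_def val_gt_def polys_over_def)

lemma maximal_ideal_subset: "maximal_ideal v \<subseteq> valuation_ring_set v"
  by (auto simp: maximal_ideal_def valuation_ring_set_def)

section \<open>Reduction modulo the maximal ideal\<close>

lemma cring_valuation_ring: "cring (valuation_ring v)"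
proof (rule cringI)
  have minus: "- x \<in> valuation_ring_set v" if "x \<in> valuation_ring_set v" for x
    using that by (auto simp: valuation_ring_set_def)
  show "abelian_group (valuation_ring v)"
    by (rule abelian_groupI)
      (auto simp: valuation_ring_def valuation_ring_set_eq add.assoc add.commute val_ge_add
        intro: bexI[OF _ minus, unfolded valuation_ring_set_eq])
  show "comm_monoid (valuation_ring v)"
    by (rule comm_monoidI)
      (use val_ge_mult[of _ 0 _ 0] in
        \<open>auto simp: valuation_ring_def valuation_ring_set_eq mult.assoc mult.commute val_ge_def[of _ 0]\<close>)
qed (simp add: valuation_ring_def distrib_right)

text \<open>
  An element of the valuation ring outside \<open>M\<^sub>v\<close> has value \<open>0\<close>, so its inverse is integral too.  An ideal
  that contains such an element is therefore the whole ring.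
\<close>

lemma maximalideal_maximal_ideal: "maximalideal (maximal_ideal v) (valuation_ring v)"
proof (rule maximalidealI)
  interpret R: cring "valuation_ring v" by (rule cring_valuation_ring)
  have R_simps: "carrier (valuation_ring v) = valuation_ring_set v"
    "x \<oplus>\<^bsub>valuation_ring v\<^esub> y = x + y" "x \<otimes>\<^bsub>valuation_ring v\<^esub> y = x * y"
    "\<zero>\<^bsub>valuation_ring v\<^esub> = 0" "\<one>\<^bsub>valuation_ring v\<^esub> = 1" for x y
    by (simp_all add: valuation_ring_def)
  have neg: "\<ominus>\<^bsub>valuation_ring v\<^esub> x = - x" if "x \<in> valuation_ring_set v" for x
    using that by (intro R.minus_equality) (auto simp: R_simps valuation_ring_set_def)
  show "ideal (maximal_ideal v) (valuation_ring v)"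
  proof (rule idealI)
    show "ring (valuation_ring v)" by (rule R.ring_axioms)
    show "subgroup (maximal_ideal v) (add_monoid (valuation_ring v))"
    proof (rule R.add.subgroupI)
      show "\<ominus>\<^bsub>valuation_ring v\<^esub> a \<in> maximal_ideal v" if "a \<in> maximal_ideal v" for a
        using that neg[of a] maximal_ideal_subset by (auto simp: maximal_ideal_def)
      show "maximal_ideal v \<noteq> {}"
        by (auto simp: maximal_ideal_def)
      show "a \<oplus>\<^bsub>valuation_ring v\<^esub> b \<in> maximal_ideal v"
        if "a \<in> maximal_ideal v" "b \<in> maximal_ideal v" for a b
        using that by (simp add: R_simps maximal_ideal_eq val_gt_add)
    qed (use maximal_ideal_subset in \<open>auto simp: R_simps\<close>)
    show "x \<otimes>\<^bsub>valuation_ring v\<^esub> a \<in> maximal_ideal v"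
      "a \<otimes>\<^bsub>valuation_ring v\<^esub> x \<in> maximal_ideal v"
      if "a \<in> maximal_ideal v" "x \<in> carrier (valuation_ring v)" for a x
      using that val_gt_mult_left[of a 0 x 0] val_gt_mult_right[of x 0 a 0]
      by (auto simp: R_simps maximal_ideal_eq valuation_ring_set_eq)
  qed
  show "carrier (valuation_ring v) \<noteq> maximal_ideal v"
  proof -
    have "1 \<in> valuation_ring_set v" "1 \<notin> maximal_ideal v"
      by (auto simp: valuation_ring_set_def maximal_ideal_def)
    then show ?thesis by (auto simp: R_simps)
  qed
  fix J
  assume J: "ideal J (valuation_ring v)" "maximal_ideal v \<subseteq> J" "J \<subseteq> carrier (valuation_ring v)"
  interpret J: ideal J "valuation_ring v" by (rule J)
  show "J = maximal_ideal v \<or> J = carrier (valuation_ring v)"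
  proof (cases "J = maximal_ideal v")
    case False
    then obtain x where x: "x \<in> J" "x \<notin> maximal_ideal v" using J by blast
    then have "x \<noteq> 0" "v x = 0"
      using J(3) by (auto simp: R_simps maximal_ideal_def valuation_ring_set_def)
    then have "inverse x \<in> valuation_ring_set v"
      by (simp add: valuation_ring_set_def val_inverse)
    then have "inverse x * x \<in> J"
      using J.I_l_closed[OF x(1), of "inverse x"] by (simp add: R_simps)
    then have "\<one>\<^bsub>valuation_ring v\<^esub> \<in> J"
      using \<open>x \<noteq> 0\<close> by (simp add: R_simps)
    then show ?thesis using J.one_imp_carrier by blast
  qed simp
qed

lemma field_residue_field: "field (residue_field v)"
  unfolding residue_field_def
  by (rule maximalideal.quotient_is_field[OF maximalideal_maximal_ideal cring_valuation_ring])

abbreviation residue :: "'a \<Rightarrow> 'a set" where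
  "residue c \<equiv> maximal_ideal v +>\<^bsub>valuation_ring v\<^esub> c"

lemma residue_hom: "residue \<in> ring_hom (valuation_ring v) (residue_field v)"
  unfolding residue_field_def
  using maximalideal_maximal_ideal by (intro ideal.rcos_ring_hom) (rule maximalideal.axioms)

lemma residue_eq_zero_iff:
  assumes "c \<in> valuation_ring_set v"
  shows "residue c = \<zero>\<^bsub>residue_field v\<^esub> \<longleftrightarrow> c \<in> maximal_ideal v"
proof -
  have I: "ideal (maximal_ideal v) (valuation_ring v)"
    using maximalideal_maximal_ideal by (rule maximalideal.axioms)
  interpret R: cring "valuation_ring v" by (rule cring_valuation_ring)
  show ?thesis
    using ideal.rcos_const_imp_mem[OF I] R.a_rcos_zero[OF I] assms
    by (auto simp: residue_field_def FactRing_def valuation_ring_def)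
qed

interpretation k: field "residue_field v" by (rule field_residue_field)

interpretation res: ring_hom_cring "valuation_ring v" "residue_field v" residue
  by (intro ring_hom_cringI ring_hom_ringI2 cring.axioms cring_valuation_ring k.is_cring residue_hom)

lemma residue_closed: "c \<in> valuation_ring_set v \<Longrightarrow> residue c \<in> carrier (residue_field v)"
  using res.hom_closed[of c] by (simp add: valuation_ring_def)

lemma residue_zero: "residue 0 = \<zero>\<^bsub>residue_field v\<^esub>"
  using res.hom_zero by (simp add: valuation_ring_def)

lemma residue_add:
  "a \<in> valuation_ring_set v \<Longrightarrow> b \<in> valuation_ring_set v \<Longrightarrow>
    residue (a + b) = residue a \<oplus>\<^bsub>residue_field v\<^esub> residue b"
  using res.hom_add[of a b] by (simp add: valuation_ring_def)

lemma residue_mult: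
  "a \<in> valuation_ring_set v \<Longrightarrow> b \<in> valuation_ring_set v \<Longrightarrow>
    residue (a * b) = residue a \<otimes>\<^bsub>residue_field v\<^esub> residue b"
  using res.hom_mult[of a b] by (simp add: valuation_ring_def)

lemma residue_sum:
  assumes "finite A" "\<And>i. i \<in> A \<Longrightarrow> f i \<in> valuation_ring_set v"
  shows "residue (sum f A) = (\<Oplus>\<^bsub>residue_field v\<^esub>i\<in>A. residue (f i))"
  using assms
proof (induction A rule: finite_induct)
  case (insert x A)
  then show ?case
    using sum_in_val_ge[of A f 0]
    by (simp add: residue_add residue_closed valuation_ring_set_eq k.finsum_insert Pi_def)
qed (simp add: residue_zero)

lemma reduce_poly_in_carrier:
  assumes "p \<in> integral_polys v"
  shows "reduce_poly v p \<in> carrier (univ_poly (residue_field v) (carrier (residue_field v)))"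
proof -
  have "set (map residue (rev (Polynomial.coeffs p))) \<subseteq> carrier (residue_field v)"
    using assms by (auto simp: Polynomial.coeffs_def integral_polys_def residue_closed)
  then show ?thesis
    unfolding reduce_poly_def univ_poly_def
    by (simp add: k.normalize_gives_polynomial)
qed

lemma coeff_reduce_poly:
  "ring.coeff (residue_field v) (reduce_poly v p) i = residue (Polynomial.coeff p i)"
proof -
  let ?l = "map residue (rev (Polynomial.coeffs p))"
  have "ring.coeff (residue_field v) (reduce_poly v p) i = k.coeff ?l i"
    unfolding reduce_poly_def by (simp add: k.normalize_coeff[symmetric])
  also have "\<dots> = residue (Polynomial.coeff p i)"
  proof (cases "i < length ?l")
    case True
    then have i: "i < length (Polynomial.coeffs p)" by simp
    then have "k.coeff ?l i = residue (rev (Polynomial.coeffs p) ! (length (Polynomial.coeffs p) - 1 - i))"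
      by (subst k.coeff_nth) auto
    also have "rev (Polynomial.coeffs p) ! (length (Polynomial.coeffs p) - 1 - i) = Polynomial.coeffs p ! i"
      using i by (subst rev_nth) auto
    also have "\<dots> = Polynomial.coeff p i"
      using i by (simp add: nth_default_coeffs_eq[symmetric] nth_default_def)
    finally show ?thesis .
  next
    case False
    then have "Polynomial.coeff p i = 0"
      by (simp add: nth_default_coeffs_eq[symmetric] nth_default_def)
    then show ?thesis
      using False by (subst k.coeff_length) (auto simp: residue_zero)
  qed
  finally show ?thesis .
qed

text \<open>
  Coefficient lists are compared through their coefficient functions, which hides the normalization
  that strips leading zeros.
\<close>

lemma reduce_poly_eqI:
  assumes "p \<in> integral_polys v" "q \<in> carrier (univ_poly (residue_field v) (carrier (residue_field v)))"
    and "\<And>i. residue (Polynomial.coeff p i) = ring.coeff (residue_field v) q i"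
  shows "reduce_poly v p = q"
  using assms reduce_poly_in_carrier[OF assms(1)]
  by (subst k.coeff_iff_polynomial_cond[of "carrier (residue_field v)"])
     (auto simp: univ_poly_def coeff_reduce_poly)

lemma reduce_poly_eq_Nil_iff:
  assumes "p \<in> integral_polys v"
  shows "reduce_poly v p = [] \<longleftrightarrow> p \<in> polys_over (maximal_ideal v)"
proof -
  have *: "residue (Polynomial.coeff p i) = \<zero>\<^bsub>residue_field v\<^esub> \<longleftrightarrow>
    Polynomial.coeff p i \<in> maximal_ideal v" for i
    using assms by (intro residue_eq_zero_iff) (simp add: integral_polys_def)
  show ?thesis
  proof
    assume "reduce_poly v p = []"
    then have "residue (Polynomial.coeff p i) = \<zero>\<^bsub>residue_field v\<^esub>" for i
      using coeff_reduce_poly[of p i] by simp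
    then show "p \<in> polys_over (maximal_ideal v)"
      by (simp add: * polys_over_def)
  next
    assume "p \<in> polys_over (maximal_ideal v)"
    then show "reduce_poly v p = []"
      by (intro reduce_poly_eqI assms) (auto simp: * polys_over_def univ_poly_def k.zero_is_polynomial)
  qed
qed

lemma integral_polys_mult:
  "p \<in> integral_polys v \<Longrightarrow> q \<in> integral_polys v \<Longrightarrow> p * q \<in> integral_polys v"
  using val_ge_mult[of _ 0 _ 0]
  by (auto simp: integral_polys_eq polys_over_def Polynomial.coeff_mult intro!: sum_in_val_ge)

lemma reduce_poly_mult:
  assumes p: "p \<in> integral_polys v" and q: "q \<in> integral_polys v"
  shows "reduce_poly v (p * q) =
    reduce_poly v p \<otimes>\<^bsub>univ_poly (residue_field v) (carrier (residue_field v))\<^esub> reduce_poly v q"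
proof (rule reduce_poly_eqI)
  show "p * q \<in> integral_polys v" using p q by (rule integral_polys_mult)
  interpret P: ring "univ_poly (residue_field v) (carrier (residue_field v))"
    by (rule k.univ_poly_is_ring[OF k.carrier_is_subring])
  show "reduce_poly v p \<otimes>\<^bsub>univ_poly (residue_field v) (carrier (residue_field v))\<^esub> reduce_poly v q
      \<in> carrier (univ_poly (residue_field v) (carrier (residue_field v)))"
    using p q by (intro P.m_closed reduce_poly_in_carrier)
  fix i
  have coeffs: "Polynomial.coeff p j \<in> valuation_ring_set v" "Polynomial.coeff q j \<in> valuation_ring_set v" for j
    using p q by (auto simp: integral_polys_def)
  have sets: "set (reduce_poly v p) \<subseteq> carrier (residue_field v)" "set (reduce_poly v q) \<subseteq> carrier (residue_field v)"
    using reduce_poly_in_carrier[OF p] reduce_poly_in_carrier[OF q]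
    by (auto simp: univ_poly_def k.polynomial_incl polynomial_def)
  have prods: "a * b \<in> valuation_ring_set v"
    if "a \<in> valuation_ring_set v" "b \<in> valuation_ring_set v" for a b
    using that val_ge_mult[of a 0 b 0] by (simp add: valuation_ring_set_eq)
  have "residue (Polynomial.coeff (p * q) i) =
      (\<Oplus>\<^bsub>residue_field v\<^esub>j\<in>{..i}. residue (Polynomial.coeff p j * Polynomial.coeff q (i - j)))"
    unfolding Polynomial.coeff_mult by (rule residue_sum) (auto simp: coeffs prods)
  also have "\<dots> = (\<Oplus>\<^bsub>residue_field v\<^esub>j\<in>{..i}. k.coeff (reduce_poly v p) j
      \<otimes>\<^bsub>residue_field v\<^esub> k.coeff (reduce_poly v q) (i - j))"
    by (intro k.finsum_cong') (auto simp: coeff_reduce_poly residue_mult residue_closed coeffs)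
  also have "\<dots> = k.coeff (k.poly_mult (reduce_poly v p) (reduce_poly v q)) i"
    using sets by (simp add: k.poly_mult_coeff)
  finally show "residue (Polynomial.coeff (p * q) i) = k.coeff (reduce_poly v p
      \<otimes>\<^bsub>univ_poly (residue_field v) (carrier (residue_field v))\<^esub> reduce_poly v q) i"
    by (simp add: univ_poly_def)
qed

lemma length_reduce_poly_le: "length (reduce_poly v p) \<le> length (Polynomial.coeffs p)"
  unfolding reduce_poly_def by (rule order_trans[OF k.normalize_length_le]) simp

text \<open>
  The leading coefficient \<open>1\<close> survives the reduction, so the degree does not drop.
\<close>

lemma length_reduce_poly_monic:
  assumes "Polynomial.lead_coeff p = 1"
  shows "length (reduce_poly v p) = Suc (Polynomial.degree p)"
proof -
  have "p \<noteq> 0" using assms by auto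
  then have len: "length (Polynomial.coeffs p) = Suc (Polynomial.degree p)"
    by (simp add: length_coeffs)
  have "k.coeff (reduce_poly v p) (Polynomial.degree p) \<noteq> \<zero>\<^bsub>residue_field v\<^esub>"
    unfolding coeff_reduce_poly assms
    by (subst residue_eq_zero_iff) (auto simp: valuation_ring_set_def maximal_ideal_def)
  then have "\<not> length (reduce_poly v p) \<le> Polynomial.degree p"
    using k.coeff_length by blast
  then show ?thesis using length_reduce_poly_le[of p] len by linarith
qed

text \<open>
  Over the residue field an irreducible polynomial is prime, so the reduction of \<open>\<phi>\<close> divides that of \<open>p\<close>
  or of \<open>q\<close>.  The degree bounds leave only the zero polynomial as a multiple.
\<close>

lemma irreducible_mod_prime:
  assumes \<phi>: "\<phi> \<in> integral_polys v" "Polynomial.lead_coeff \<phi> = 1" "irreducible_mod v \<phi>"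
    and p: "p \<in> integral_polys v" "Polynomial.degree p < Polynomial.degree \<phi>"
    and q: "q \<in> integral_polys v" "Polynomial.degree q < Polynomial.degree \<phi>"
    and h: "h \<in> integral_polys v" and r: "p * q - \<phi> * h \<in> polys_over (maximal_ideal v)"
  shows "p \<in> polys_over (maximal_ideal v) \<or> q \<in> polys_over (maximal_ideal v)"
proof -
  let ?P = "univ_poly (residue_field v) (carrier (residue_field v))"
  note subfield = k.carrier_is_subfield
  note subring = k.carrier_is_subring
  have "reduce_poly v (p * q) = reduce_poly v (\<phi> * h)"
  proof (rule reduce_poly_eqI)
    fix i
    let ?a = "Polynomial.coeff (p * q - \<phi> * h) i" and ?b = "Polynomial.coeff (\<phi> * h) i"
    have a: "?a \<in> maximal_ideal v"
      using r by (simp only: polys_over_def mem_Collect_eq)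
    have b: "?b \<in> valuation_ring_set v"
      using integral_polys_mult[OF \<phi>(1) h] by (simp only: integral_polys_def mem_Collect_eq)
    have "residue (?a + ?b) = residue ?a \<oplus>\<^bsub>residue_field v\<^esub> residue ?b"
      using a b maximal_ideal_subset by (intro residue_add) auto
    also have "residue ?a = \<zero>\<^bsub>residue_field v\<^esub>"
      using a maximal_ideal_subset by (subst residue_eq_zero_iff) auto
    finally show "residue (Polynomial.coeff (p * q) i) = k.coeff (reduce_poly v (\<phi> * h)) i"
      using b by (simp add: coeff_reduce_poly residue_closed)
  qed (intro integral_polys_mult reduce_poly_in_carrier \<phi> p q h)+
  then have eq: "reduce_poly v p \<otimes>\<^bsub>?P\<^esub> reduce_poly v q = reduce_poly v \<phi> \<otimes>\<^bsub>?P\<^esub> reduce_poly v h"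
    using p q \<phi> h by (simp add: reduce_poly_mult)
  have "pprime\<^bsub>residue_field v\<^esub> (carrier (residue_field v)) (reduce_poly v \<phi>)"
    using \<phi> by (subst k.pprime_iff_pirreducible[OF subfield reduce_poly_in_carrier])
      (auto simp: irreducible_mod_def)
  moreover have "reduce_poly v \<phi> pdivides\<^bsub>residue_field v\<^esub> reduce_poly v p \<otimes>\<^bsub>?P\<^esub> reduce_poly v q"
    unfolding pdivides_def factor_def eq using reduce_poly_in_carrier[OF h] by blast
  ultimately have "reduce_poly v \<phi> pdivides\<^bsub>residue_field v\<^esub> reduce_poly v p \<or>
      reduce_poly v \<phi> pdivides\<^bsub>residue_field v\<^esub> reduce_poly v q"
    using k.pprimeE(3)[OF subfield reduce_poly_in_carrier[OF \<phi>(1)]]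
      reduce_poly_in_carrier[OF p(1)] reduce_poly_in_carrier[OF q(1)] by blast
  moreover have "g \<in> polys_over (maximal_ideal v)"
    if g: "g \<in> integral_polys v" "Polynomial.degree g < Polynomial.degree \<phi>"
      "reduce_poly v \<phi> pdivides\<^bsub>residue_field v\<^esub> reduce_poly v g" for g
  proof (rule ccontr)
    assume "g \<notin> polys_over (maximal_ideal v)"
    then have "reduce_poly v g \<noteq> []" using g by (simp add: reduce_poly_eq_Nil_iff)
    then have "length (reduce_poly v \<phi>) - 1 \<le> length (reduce_poly v g) - 1"
      using k.pdivides_imp_degree_le[OF subring reduce_poly_in_carrier[OF \<phi>(1)]
          reduce_poly_in_carrier[OF g(1)]] g(3) by blast
    moreover have "length (Polynomial.coeffs g) \<le> Suc (Polynomial.degree g)"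
      by (cases "g = 0") (auto simp: length_coeffs)
    ultimately show False
      using length_reduce_poly_le[of g] length_reduce_poly_monic[OF \<phi>(2)] g(2) by linarith
  qed
  ultimately show ?thesis using p q by blast
qed

section \<open>Division by a monic integral polynomial\<close>

lemma polys_over_add:
  assumes "\<And>x y. x \<in> S \<Longrightarrow> y \<in> S \<Longrightarrow> x + y \<in> S" "p \<in> polys_over S" "q \<in> polys_over S"
  shows "p + q \<in> polys_over S"
  using assms by (auto simp: polys_over_def)

lemma polys_over_val_ge_mult:
  "p \<in> polys_over (val_ge v g) \<Longrightarrow> q \<in> polys_over (val_ge v h) \<Longrightarrow> p * q \<in> polys_over (val_ge v (g + h))"
  by (auto simp: polys_over_def Polynomial.coeff_mult intro!: sum_in_val_ge val_ge_mult)

lemma polys_over_val_gt_mult_left: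
  "p \<in> polys_over (val_gt v g) \<Longrightarrow> q \<in> polys_over (val_ge v h) \<Longrightarrow> p * q \<in> polys_over (val_gt v (g + h))"
  by (auto simp: polys_over_def Polynomial.coeff_mult intro!: sum_in_val_gt val_gt_mult_left)

lemma polys_over_val_gt_mult_right:
  "p \<in> polys_over (val_ge v g) \<Longrightarrow> q \<in> polys_over (val_gt v h) \<Longrightarrow> p * q \<in> polys_over (val_gt v (g + h))"
  by (auto simp: polys_over_def Polynomial.coeff_mult intro!: sum_in_val_gt val_gt_mult_right)

lemma polys_over_sum:
  assumes "\<And>x y. x \<in> S \<Longrightarrow> y \<in> S \<Longrightarrow> x + y \<in> S" "0 \<in> S" "\<And>i. i \<in> A \<Longrightarrow> f i \<in> polys_over S"
  shows "sum f A \<in> polys_over S"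
  using assms(3)
proof (induction A rule: infinite_finite_induct)
  case (insert x A)
  then show ?case using polys_over_add[OF assms(1)] by simp
qed (auto simp: polys_over_def assms(2))

text \<open>
  The set \<open>S\<close> stands for an \<open>R\<^sub>v\<close>-submodule of the field, so that a single induction covers the closed and
  the open steps of the filtration.  The long division by a monic integral polynomial only uses sums and
  integral multiples of the coefficients of \<open>p\<close>, and these stay in \<open>S\<close>.
\<close>

lemma div_mod_monic_in_polys_over:
  assumes \<phi>: "\<phi> \<in> integral_polys v" "Polynomial.lead_coeff \<phi> = 1" "Polynomial.degree \<phi> > 0"
    and add: "\<And>x y. x \<in> S \<Longrightarrow> y \<in> S \<Longrightarrow> x + y \<in> S"
    and zero: "0 \<in> S"
    and mult: "\<And>r x. r \<in> valuation_ring_set v \<Longrightarrow> x \<in> S \<Longrightarrow> r * x \<in> S"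
    and p: "p \<in> polys_over S"
  shows "p div \<phi> \<in> polys_over S \<and> p mod \<phi> \<in> polys_over S"
  using p
proof (induction "Polynomial.degree p" arbitrary: p rule: less_induct)
  case less
  show ?case
  proof (cases "Polynomial.degree p < Polynomial.degree \<phi>")
    case True
    then show ?thesis
      using less.prems zero by (simp add: div_poly_less mod_poly_less polys_over_def)
  next
    case False
    define c k where "c = Polynomial.lead_coeff p" and "k = Polynomial.degree p - Polynomial.degree \<phi>"
    define q where "q = p - Polynomial.monom c k * \<phi>"
    have c: "c \<in> S" using less.prems by (simp add: c_def polys_over_def)
    have uminus: "- x \<in> S" if "x \<in> S" for x
      using mult[of "-1" x] that by (simp add: valuation_ring_set_def)
    have coeff_q: "Polynomial.coeff q i =
        Polynomial.coeff p i + - (if k \<le> i then Polynomial.coeff \<phi> (i - k) * c else 0)" for i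
      by (simp add: q_def Polynomial.coeff_monom_mult)
    have q: "q \<in> polys_over S"
      using less.prems \<phi>(1) c
      by (auto simp: polys_over_def coeff_q integral_polys_def zero
          simp del: add_uminus_conv_diff intro!: add uminus mult)
    have p_eq: "p = Polynomial.monom c k * \<phi> + q" by (simp add: q_def)
    have "Polynomial.degree q < Polynomial.degree p"
    proof -
      have "Polynomial.degree q \<le> Polynomial.degree p"
        unfolding q_def using False \<phi>
        by (intro degree_diff_le order_trans[OF degree_mult_le])
           (auto simp: k_def intro: order_trans[OF add_right_mono[OF degree_monom_le]])
      moreover have "Polynomial.coeff q (Polynomial.degree p) = 0"
        using False \<phi>(2) by (simp add: coeff_q k_def c_def)
      then have "Polynomial.degree q \<noteq> Polynomial.degree p" if "q \<noteq> 0"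
        using that by (metis leading_coeff_0_iff)
      moreover have "Polynomial.degree q < Polynomial.degree p" if "q = 0"
        using False \<phi>(3) that by simp
      ultimately show ?thesis
        by (cases "q = 0") (auto simp: le_less)
    qed
    then have IH: "q div \<phi> \<in> polys_over S" "q mod \<phi> \<in> polys_over S"
      using less.hyps[of q] q by auto
    have "\<phi> \<noteq> 0" using \<phi>(3) by auto
    then have "p div \<phi> = Polynomial.monom c k + q div \<phi>" "p mod \<phi> = q mod \<phi>"
      by (simp_all add: p_eq)
    moreover have "Polynomial.monom c k \<in> polys_over S"
      using c zero by (auto simp: polys_over_def)
    ultimately show ?thesis
      using IH polys_over_add[OF add] by simp
  qed
qed

section \<open>The Gaussian prolongation\<close>

lemma gauss_le_coeff:
  "Polynomial.coeff p i \<noteq> 0 \<Longrightarrow> gauss v p \<le> v (Polynomial.coeff p i)"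
proof -
  assume *: "Polynomial.coeff p i \<noteq> 0"
  have "{v (Polynomial.coeff p i) | i. Polynomial.coeff p i \<noteq> 0} \<subseteq>
      (\<lambda>i. v (Polynomial.coeff p i)) ` {..Polynomial.degree p}"
    by (auto intro: le_degree)
  then have "finite {v (Polynomial.coeff p i) | i. Polynomial.coeff p i \<noteq> 0}"
    by (rule finite_subset) simp
  then show ?thesis unfolding gauss_def using * by (intro Min_le) auto
qed

lemma gauss_eq_coeff:
  assumes "p \<noteq> 0"
  obtains i where "Polynomial.coeff p i \<noteq> 0" "gauss v p = v (Polynomial.coeff p i)"
proof -
  let ?A = "{v (Polynomial.coeff p i) | i. Polynomial.coeff p i \<noteq> 0}"
  have "?A \<subseteq> (\<lambda>i. v (Polynomial.coeff p i)) ` {..Polynomial.degree p}"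
    by (auto intro: le_degree)
  then have "finite ?A"
    by (rule finite_subset) simp
  moreover have "?A \<noteq> {}"
    using assms by (auto intro: exI[of _ "Polynomial.degree p"])
  ultimately have "gauss v p \<in> ?A" unfolding gauss_def by (rule Min_in)
  then show ?thesis using that by auto
qed

lemma polys_over_val_iff:
  assumes "p \<noteq> 0"
  shows polys_over_val_ge_iff: "p \<in> polys_over (val_ge v g) \<longleftrightarrow> g \<le> gauss v p"
    and polys_over_val_gt_iff: "p \<in> polys_over (val_gt v g) \<longleftrightarrow> g < gauss v p"
proof -
  obtain i where i: "Polynomial.coeff p i \<noteq> 0" "gauss v p = v (Polynomial.coeff p i)"
    using assms by (rule gauss_eq_coeff)
  show "p \<in> polys_over (val_ge v g) \<longleftrightarrow> g \<le> gauss v p"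
  proof
    assume "p \<in> polys_over (val_ge v g)"
    then have "Polynomial.coeff p i \<in> val_ge v g" unfolding polys_over_def by blast
    then show "g \<le> gauss v p" using i by (simp add: val_ge_def)
  qed (auto simp: polys_over_def val_ge_def intro: order_trans gauss_le_coeff)
  show "p \<in> polys_over (val_gt v g) \<longleftrightarrow> g < gauss v p"
  proof
    assume "p \<in> polys_over (val_gt v g)"
    then have "Polynomial.coeff p i \<in> val_gt v g" unfolding polys_over_def by blast
    then show "g < gauss v p" using i by (simp add: val_gt_def)
  qed (auto simp: polys_over_def val_gt_def intro: less_le_trans gauss_le_coeff)
qed

lemma primitive_part:
  assumes "p \<noteq> 0"
  obtains c p0 where "c \<noteq> 0" "v c = gauss v p" "p = Polynomial.smult c p0"
    "p0 \<in> integral_polys v" "p0 \<notin> polys_over (maximal_ideal v)"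
proof -
  obtain i where i: "Polynomial.coeff p i \<noteq> 0" "gauss v p = v (Polynomial.coeff p i)"
    using assms by (rule gauss_eq_coeff)
  let ?c = "Polynomial.coeff p i"
  let ?p0 = "Polynomial.smult (inverse ?c) p"
  have "0 \<le> v (Polynomial.coeff ?p0 j)" if "Polynomial.coeff ?p0 j \<noteq> 0" for j
    using that i gauss_le_coeff[of p j] by (simp add: val_mult val_inverse)
  then have "?p0 \<in> integral_polys v"
    unfolding integral_polys_def valuation_ring_set_def by blast
  moreover have "?p0 \<notin> polys_over (maximal_ideal v)"
  proof
    assume "?p0 \<in> polys_over (maximal_ideal v)"
    then have "Polynomial.coeff ?p0 i \<in> maximal_ideal v"
      unfolding polys_over_def by blast
    then show False using i by (simp add: maximal_ideal_def)
  qed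
  ultimately show ?thesis using i that[of ?c ?p0] by simp
qed

text \<open>
  Combined with the division lemma, this says that the remainder has exactly the value of the product.
  Dividing \<open>p\<close> and \<open>q\<close> by coefficients of least value reduces the claim to value \<open>0\<close>.  There a remainder
  with coefficients in \<open>M\<^sub>v\<close> would contradict the primality of \<open>\<phi>\<close> modulo \<open>M\<^sub>v\<close>.
\<close>

lemma gauss_mult_mod:
  assumes \<phi>: "\<phi> \<in> integral_polys v" "Polynomial.lead_coeff \<phi> = 1" "irreducible_mod v \<phi>"
    and p: "p \<noteq> 0" "Polynomial.degree p < Polynomial.degree \<phi>"
    and q: "q \<noteq> 0" "Polynomial.degree q < Polynomial.degree \<phi>"
  shows "p * q mod \<phi> \<notin> polys_over (val_gt v (gauss v p + gauss v q))"
proof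
  assume *: "p * q mod \<phi> \<in> polys_over (val_gt v (gauss v p + gauss v q))"
  obtain c p0 where c: "c \<noteq> 0" "v c = gauss v p" "p = Polynomial.smult c p0"
    "p0 \<in> integral_polys v" "p0 \<notin> polys_over (maximal_ideal v)"
    using p(1) by (rule primitive_part)
  obtain d q0 where d: "d \<noteq> 0" "v d = gauss v q" "q = Polynomial.smult d q0"
    "q0 \<in> integral_polys v" "q0 \<notin> polys_over (maximal_ideal v)"
    using q(1) by (rule primitive_part)
  have "p * q mod \<phi> = Polynomial.smult (c * d) (p0 * q0 mod \<phi>)"
    by (simp add: c d mod_smult_left mult.commute)
  then have "Polynomial.smult (inverse (c * d)) (p * q mod \<phi>) =
      Polynomial.smult (inverse (c * d) * (c * d)) (p0 * q0 mod \<phi>)"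
    by simp
  then have "p0 * q0 mod \<phi> = Polynomial.smult (inverse (c * d)) (p * q mod \<phi>)"
    using c(1) d(1) by (simp del: inverse_mult_distrib)
  moreover have "inverse (c * d) \<in> val_ge v (- (gauss v p + gauss v q))"
    using c d by (simp add: val_ge_def val_inverse val_mult del: inverse_mult_distrib)
  ultimately have "p0 * q0 mod \<phi> \<in> polys_over (maximal_ideal v)"
    using * val_gt_mult_right[of "inverse (c * d)" "- (gauss v p + gauss v q)" _ "gauss v p + gauss v q"]
    by (auto simp: polys_over_def maximal_ideal_eq)
  moreover have "p0 * q0 - \<phi> * (p0 * q0 div \<phi>) = p0 * q0 mod \<phi>"
    by (simp add: minus_mult_div_eq_mod)
  moreover have "p0 * q0 div \<phi> \<in> integral_polys v"
    using div_mod_monic_in_polys_over[of \<phi> "val_ge v 0" "p0 * q0"] \<phi> p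
      val_ge_add val_ge_smult integral_polys_mult[OF c(4) d(4)]
    by (auto simp: integral_polys_eq)
  ultimately have "p0 \<in> polys_over (maximal_ideal v) \<or> q0 \<in> polys_over (maximal_ideal v)"
    using p q c d by (intro irreducible_mod_prime[OF \<phi>, of p0 q0 "p0 * q0 div \<phi>"]) auto
  then show False using c d by blast
qed

end

section \<open>Multiplication of expansions\<close>

text \<open>
  A polynomial \<open>E\<close> over \<open>K[x]\<close> encodes a sum of multiples of powers of \<open>\<phi>\<close>, with coefficients of any
  degree, and its value at \<open>\<phi>\<close> is this sum.  Multiplication of such polynomials is then convolution of
  the coefficients, and carrying is the identity below.
\<close>

lemma poly_divmod_coeffs:
  fixes \<phi> :: "'a::field poly"
  shows "poly (map_poly (\<lambda>e. e mod \<phi>) E) \<phi> + \<phi> * poly (map_poly (\<lambda>e. e div \<phi>) E) \<phi> = poly E \<phi>"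
proof (induction E)
  case (pCons e E)
  have "poly (pCons e E) \<phi> = (e mod \<phi> + \<phi> * (e div \<phi>)) +
      \<phi> * (poly (map_poly (\<lambda>e. e mod \<phi>) E) \<phi> + \<phi> * poly (map_poly (\<lambda>e. e div \<phi>) E) \<phi>)"
    using pCons.IH by simp
  then show ?case
    by (simp add: map_poly_pCons algebra_simps del: mod_mult_div_eq mult_div_mod_eq div_mult_mod_eq mod_div_mult_eq)
qed simp

lemma expansion_poly:
  fixes A :: "'a::field poly poly"
  assumes "Polynomial.degree \<phi> > 0"
    and "\<And>i. Polynomial.coeff A i \<noteq> 0 \<Longrightarrow> Polynomial.degree (Polynomial.coeff A i) < Polynomial.degree \<phi>"
  shows "expansion \<phi> (poly A \<phi>) = Polynomial.coeff A"
proof -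
  have "is_expansion \<phi> (poly A \<phi>) (Polynomial.coeff A)"
    unfolding is_expansion_def using assms
    by (auto simp: poly_altdef coeff_eq_0 intro!: exI[of _ "Polynomial.degree A"])
  then show ?thesis
    using is_expansion_coeff[OF is_expansion_expansion[OF assms(1)] assms(1)]
      is_expansion_coeff[of \<phi> "poly A \<phi>" "Polynomial.coeff A"] assms(1) by (intro ext) simp
qed

lemma degree_expansion_less:
  assumes "Polynomial.degree \<phi> > 0" "expansion \<phi> f i \<noteq> 0"
  shows "Polynomial.degree (expansion \<phi> f i) < Polynomial.degree \<phi>"
  using is_expansion_expansion[OF assms(1), of f] assms(2) by (simp add: is_expansion_def)

lemma ex_poly_eq_expansion:
  fixes \<phi> f :: "'a::field poly"
  assumes "Polynomial.degree \<phi> > 0"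
  obtains A where "poly A \<phi> = f" "Polynomial.coeff A = expansion \<phi> f"
proof -
  obtain n where n: "\<forall>i>n. expansion \<phi> f i = 0" "f = (\<Sum>i\<le>n. expansion \<phi> f i * \<phi> ^ i)"
    using is_expansion_expansion[OF assms, of f] by (auto simp: is_expansion_def)
  define A where "A = (\<Sum>i\<le>n. Polynomial.monom (expansion \<phi> f i) i)"
  have "poly A \<phi> = f"
    by (subst n(2)) (simp add: A_def poly_sum poly_monom)
  moreover have "Polynomial.coeff A i = expansion \<phi> f i" for i
    using n(1) by (simp add: A_def coeff_sum not_le)
  ultimately show ?thesis using that by blast
qed

text \<open>
  The convolutions \<open>e k\<close> have degree below \<open>2 deg \<phi>\<close>.  Hence the carry \<open>e j div \<phi>\<close> has degree
  below \<open>deg \<phi>\<close>, and one round of carrying already yields an expansion.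
\<close>

lemma expansion_mult:
  fixes \<phi> f g :: "'a::field poly"
  assumes "Polynomial.degree \<phi> > 0"
  defines "e \<equiv> \<lambda>k. \<Sum>i\<le>k. expansion \<phi> f i * expansion \<phi> g (k - i)"
  shows "expansion \<phi> (f * g) k = e k mod \<phi> + (case k of 0 \<Rightarrow> 0 | Suc j \<Rightarrow> e j div \<phi>)"
proof -
  obtain A where A: "poly A \<phi> = f" "Polynomial.coeff A = expansion \<phi> f"
    using assms(1) by (rule ex_poly_eq_expansion)
  obtain B where B: "poly B \<phi> = g" "Polynomial.coeff B = expansion \<phi> g"
    using assms(1) by (rule ex_poly_eq_expansion)
  define C where "C = map_poly (\<lambda>e. e mod \<phi>) (A * B) + pCons 0 (map_poly (\<lambda>e. e div \<phi>) (A * B))"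
  have e: "Polynomial.coeff (A * B) j = e j" for j
    by (simp add: Polynomial.coeff_mult A B e_def)
  have C: "Polynomial.coeff C j = e j mod \<phi> + (case j of 0 \<Rightarrow> 0 | Suc i \<Rightarrow> e i div \<phi>)" for j
    by (simp add: C_def coeff_map_poly coeff_pCons e split: nat.splits)
  have deg_e: "Polynomial.degree (e j) < 2 * Polynomial.degree \<phi>" for j
  proof -
    have "Polynomial.degree (expansion \<phi> f i * expansion \<phi> g (j - i)) \<le> 2 * Polynomial.degree \<phi> - 1" for i
      using degree_expansion_less[OF assms(1), of f i] degree_expansion_less[OF assms(1), of g "j - i"]
      by (cases "expansion \<phi> f i = 0 \<or> expansion \<phi> g (j - i) = 0") (auto simp: degree_mult_eq)
    then have "Polynomial.degree (e j) \<le> 2 * Polynomial.degree \<phi> - 1"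
      unfolding e_def by (intro degree_sum_le) auto
    then show ?thesis using assms(1) by linarith
  qed
  have "Polynomial.degree (Polynomial.coeff C j) < Polynomial.degree \<phi>" for j
  proof -
    have "\<phi> \<noteq> 0" using assms(1) by auto
    then have "Polynomial.degree (e j mod \<phi>) < Polynomial.degree \<phi>"
      using degree_mod_less[of \<phi> "e j"] assms(1) by auto
    moreover have "Polynomial.degree (e i div \<phi>) < Polynomial.degree \<phi>" for i
    proof -
      have "e i div \<phi> div \<phi> = 0"
        using deg_e[of i] \<open>\<phi> \<noteq> 0\<close>
        by (simp add: poly_div_mult_right[symmetric] div_poly_less degree_mult_eq)
      then show ?thesis
        using assms(1) by (auto simp: div_poly_eq_0_iff div_poly_less)
    qed
    ultimately show ?thesis
      unfolding C using assms(1) by (intro degree_add_less) (auto split: nat.splits)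
  qed
  moreover have "poly C \<phi> = f * g"
    using poly_divmod_coeffs[of \<phi> "A * B"] A B by (simp add: C_def)
  ultimately show ?thesis
    using expansion_poly[OF assms(1), of C] C by simp
qed

lemma expansion_nonzero_degree_le:
  assumes "Polynomial.degree \<phi> > 0" "expansion \<phi> f i \<noteq> 0"
  shows "i * Polynomial.degree \<phi> \<le> Polynomial.degree f"
proof -
  have "expansion \<phi> f i = f div \<phi> ^ i mod \<phi>"
    using is_expansion_expansion[OF assms(1)] assms(1) by (rule is_expansion_coeff)
  then have "f div \<phi> ^ i \<noteq> 0" using assms(2) by auto
  then have "\<not> Polynomial.degree f < Polynomial.degree (\<phi> ^ i)"
    using div_poly_less by blast
  moreover have "\<phi> \<noteq> 0" using assms(1) by auto
  ultimately show ?thesis by (simp add: degree_power_eq mult.commute)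
qed

section \<open>Supporting lines of the polygon of a product\<close>

text \<open>
  The least of these values is that of \<open>f\<close> under MacLane's augmentation of the Gaussian prolongation, in
  which \<open>\<phi>\<close> receives the value \<open>\<mu>\<close>.
\<close>

definition phi_value ::
  "('a::field \<Rightarrow> 'g::linordered_ab_group_add) \<Rightarrow> 'a poly \<Rightarrow> 'g \<Rightarrow> 'a poly \<Rightarrow> nat \<Rightarrow> 'g" where
  "phi_value v \<phi> \<mu> f i = gauss v (expansion \<phi> f i) + nat_mul i \<mu>"

definition supporting_indices ::
  "('a::field \<Rightarrow> 'g::linordered_ab_group_add) \<Rightarrow> 'a poly \<Rightarrow> 'g \<Rightarrow> 'a poly \<Rightarrow> nat set" where
  "supporting_indices v \<phi> \<mu> f = {i. expansion \<phi> f i \<noteq> 0 \<and>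
     (\<forall>j. expansion \<phi> f j \<noteq> 0 \<longrightarrow> phi_value v \<phi> \<mu> f i \<le> phi_value v \<phi> \<mu> f j)}"

lemma finite_expansion_support:
  assumes "Polynomial.degree \<phi> > 0"
  shows "finite {i. expansion \<phi> f i \<noteq> 0}"
proof -
  have "{i. expansion \<phi> f i \<noteq> 0} \<subseteq> {..Polynomial.degree f}"
  proof
    fix i assume "i \<in> {i. expansion \<phi> f i \<noteq> 0}"
    then have "i * Polynomial.degree \<phi> \<le> Polynomial.degree f"
      using assms by (auto intro: expansion_nonzero_degree_le)
    then show "i \<in> {..Polynomial.degree f}"
      using assms by (cases "Polynomial.degree \<phi>") auto
  qed
  then show ?thesis by (rule finite_subset) simp
qed

lemma expansion_support_nonempty:
  assumes "Polynomial.degree \<phi> > 0" "f \<noteq> 0"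
  shows "{i. expansion \<phi> f i \<noteq> 0} \<noteq> {}"
proof
  assume *: "{i. expansion \<phi> f i \<noteq> 0} = {}"
  obtain n where "f = (\<Sum>i\<le>n. expansion \<phi> f i * \<phi> ^ i)"
    using is_expansion_expansion[OF assms(1), of f] by (auto simp: is_expansion_def)
  then show False using * assms(2) by simp
qed

lemma supporting_indices_nonempty:
  assumes "Polynomial.degree \<phi> > 0" "f \<noteq> 0"
  shows "supporting_indices v \<phi> \<mu> f \<noteq> {}"
proof -
  let ?S = "{i. expansion \<phi> f i \<noteq> 0}"
  note fin = finite_expansion_support[OF assms(1), of f]
  have "Min (phi_value v \<phi> \<mu> f ` ?S) \<in> phi_value v \<phi> \<mu> f ` ?S"
    using fin expansion_support_nonempty[OF assms] by (intro Min_in) auto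
  then obtain i where "i \<in> ?S" "phi_value v \<phi> \<mu> f i = Min (phi_value v \<phi> \<mu> f ` ?S)" by auto
  then have "i \<in> supporting_indices v \<phi> \<mu> f"
    using fin by (auto simp: supporting_indices_def)
  then show ?thesis by blast
qed

context krull_valued begin

text \<open>
  The remainder of \<open>a\<^sub>s b\<^sub>t\<close> is the only contribution to the expansion of \<open>f * g\<close> that attains the
  least value, the sum of those of \<open>f\<close> and \<open>g\<close>.  All the others, the carries included, lie in the open step of the filtration.
\<close>

lemma supporting_indices_mult_singleton:
  assumes \<phi>: "\<phi> \<in> integral_polys v" "Polynomial.lead_coeff \<phi> = 1" "irreducible_mod v \<phi>"
      "Polynomial.degree \<phi> > 0"
    and lam: "0 < \<mu>"
    and f: "supporting_indices v \<phi> \<mu> f = {s}"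
    and g: "supporting_indices v \<phi> \<mu> g = {t}"
  shows "supporting_indices v \<phi> \<mu> (f * g) = {s + t}"
proof -
  let ?a = "expansion \<phi> f" and ?b = "expansion \<phi> g" and ?c = "expansion \<phi> (f * g)"
  define \<gamma> \<delta> where "\<gamma> = phi_value v \<phi> \<mu> f s" and "\<delta> = phi_value v \<phi> \<mu> g t"
  define e where "e = (\<lambda>k. \<Sum>i\<le>k. ?a i * ?b (k - i))"
  have coeffs: "(i = w \<longrightarrow> expansion \<phi> h i \<noteq> 0 \<and> gauss v (expansion \<phi> h i) = phi_value v \<phi> \<mu> h w - nat_mul i \<mu>) \<and>
      expansion \<phi> h i \<in> polys_over (val_ge v (phi_value v \<phi> \<mu> h w - nat_mul i \<mu>)) \<and>
      (i \<noteq> w \<longrightarrow> expansion \<phi> h i \<in> polys_over (val_gt v (phi_value v \<phi> \<mu> h w - nat_mul i \<mu>)))"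
    if h: "supporting_indices v \<phi> \<mu> h = {w}" for h w i
  proof (cases "expansion \<phi> h i = 0")
    case True
    moreover have "expansion \<phi> h w \<noteq> 0"
      using h by (auto simp: supporting_indices_def)
    ultimately show ?thesis by (auto simp: polys_over_def)
  next
    case False
    have w: "w \<in> supporting_indices v \<phi> \<mu> h" using h by simp
    have le: "phi_value v \<phi> \<mu> h w \<le> phi_value v \<phi> \<mu> h i"
      using False w by (simp add: supporting_indices_def)
    have less: "phi_value v \<phi> \<mu> h w < phi_value v \<phi> \<mu> h i" if "i \<noteq> w"
    proof (rule ccontr)
      assume "\<not> ?thesis"
      then have "i \<in> supporting_indices v \<phi> \<mu> h"
        using w False by (auto simp: supporting_indices_def intro: order_trans)
      then show False using h that by simp
    qed
    show ?thesis
      using False le less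
      by (auto simp: polys_over_val_ge_iff polys_over_val_gt_iff phi_value_def diff_le_eq diff_less_eq)
  qed
  (* The value required of the coefficient of the i-th power is lowered by i \<mu>, and these weights add up. *)
  have shift: "(\<gamma> - nat_mul i \<mu>) + (\<delta> - nat_mul (k - i) \<mu>) = \<gamma> + \<delta> - nat_mul k \<mu>" if "i \<le> k" for i k
    using nat_mul_add_left[of i "k - i" \<mu>] that by (simp add: algebra_simps)
  have ge: "?a i * ?b (k - i) \<in> polys_over (val_ge v (\<gamma> + \<delta> - nat_mul k \<mu>))" if "i \<le> k" for i k
    using coeffs[OF f, of i] coeffs[OF g, of "k - i"] unfolding shift[OF that, symmetric]
    by (auto simp: \<gamma>_def \<delta>_def intro: polys_over_val_ge_mult)
  have gt: "?a i * ?b (k - i) \<in> polys_over (val_gt v (\<gamma> + \<delta> - nat_mul k \<mu>))"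
    if "i \<le> k" "\<not> (i = s \<and> k = s + t)" for i k
  proof -
    have "i \<noteq> s \<or> k - i \<noteq> t" using that by auto
    then show ?thesis
      using coeffs[OF f, of i] coeffs[OF g, of "k - i"] unfolding shift[OF that(1), symmetric]
      by (auto simp: \<gamma>_def \<delta>_def intro: polys_over_val_gt_mult_left polys_over_val_gt_mult_right)
  qed
  have mod_ge: "p mod \<phi> \<in> polys_over (val_ge v g)" "p div \<phi> \<in> polys_over (val_ge v g)"
    if "p \<in> polys_over (val_ge v g)" for p g
    using div_mod_monic_in_polys_over[OF \<phi>(1,2,4), of "val_ge v g" p] that val_ge_add val_ge_smult by auto
  have mod_gt: "p mod \<phi> \<in> polys_over (val_gt v g)"
    if "p \<in> polys_over (val_gt v g)" for p g
    using div_mod_monic_in_polys_over[OF \<phi>(1,2,4), of "val_gt v g" p] that val_gt_add val_gt_smult by auto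
  have e_ge: "e k \<in> polys_over (val_ge v (\<gamma> + \<delta> - nat_mul k \<mu>))" for k
    unfolding e_def using ge val_ge_add by (intro polys_over_sum) auto
  have c_eq: "?c k = e k mod \<phi> + (case k of 0 \<Rightarrow> 0 | Suc j \<Rightarrow> e j div \<phi>)" for k
    unfolding e_def using \<phi>(4) by (rule expansion_mult)
  have carry: "(case k of 0 \<Rightarrow> 0 | Suc j \<Rightarrow> e j div \<phi>) \<in> polys_over (val_gt v (\<gamma> + \<delta> - nat_mul k \<mu>))" for k
  proof (cases k)
    case (Suc j)
    have "\<gamma> + \<delta> - nat_mul k \<mu> < \<gamma> + \<delta> - nat_mul j \<mu>"
      using lam by (simp add: Suc)
    then have "val_ge v (\<gamma> + \<delta> - nat_mul j \<mu>) \<subseteq> val_gt v (\<gamma> + \<delta> - nat_mul k \<mu>)"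
      unfolding val_ge_def val_gt_def using less_le_trans by blast
    then show ?thesis
      using mod_ge(2)[OF e_ge[of j]] by (auto simp: Suc polys_over_def)
  qed (simp add: polys_over_def)
  have c_ge: "?c k \<in> polys_over (val_ge v (\<gamma> + \<delta> - nat_mul k \<mu>))" for k
    unfolding c_eq using carry[of k] val_gt_subset_val_ge mod_ge(1)[OF e_ge[of k]]
    by (intro polys_over_add val_ge_add) (auto simp: polys_over_def)
  (* For k \<noteq> s + t no pair (i, k - i) is (s, t), so every summand of e k is strictly large. *)
  have c_gt: "?c k \<in> polys_over (val_gt v (\<gamma> + \<delta> - nat_mul k \<mu>))" if "k \<noteq> s + t" for k
  proof -
    have "e k \<in> polys_over (val_gt v (\<gamma> + \<delta> - nat_mul k \<mu>))"
      unfolding e_def using gt that val_gt_add by (intro polys_over_sum) auto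
    then show ?thesis
      unfolding c_eq using carry[of k] mod_gt val_gt_add by (intro polys_over_add) auto
  qed
  have c_st: "?c (s + t) \<notin> polys_over (val_gt v (\<gamma> + \<delta> - nat_mul (s + t) \<mu>))"
  proof
    assume *: "?c (s + t) \<in> polys_over (val_gt v (\<gamma> + \<delta> - nat_mul (s + t) \<mu>))" (is "_ \<in> ?G")
    (* Everything other than the remainder of a_s b_t is large, so that remainder would be large as well. *)
    define r where "r = (\<Sum>i\<in>{..s + t} - {s}. ?a i * ?b (s + t - i))"
    have uminus: "- p \<in> ?G" if "p \<in> ?G" for p
      using that by (auto simp: polys_over_def val_gt_def)
    have "r \<in> ?G"
      unfolding r_def using gt val_gt_add by (intro polys_over_sum) auto
    moreover have "e (s + t) = ?a s * ?b t + r"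
      unfolding e_def r_def by (subst sum.remove[of _ s]) auto
    then have "?a s * ?b t mod \<phi> =
        ?c (s + t) + - (case s + t of 0 \<Rightarrow> 0 | Suc j \<Rightarrow> e j div \<phi>) + - (r mod \<phi>)"
      unfolding c_eq by (simp add: poly_mod_add_left)
    ultimately have "?a s * ?b t mod \<phi> \<in> ?G"
      using * carry[of "s + t"] mod_gt val_gt_add uminus
      by (auto simp del: add_uminus_conv_diff intro!: polys_over_add)
    moreover have "gauss v (?a s) + gauss v (?b t) = \<gamma> + \<delta> - nat_mul (s + t) \<mu>"
      using coeffs[OF f, of s] coeffs[OF g, of t] shift[of s "s + t"] by (simp add: \<gamma>_def \<delta>_def)
    moreover have "?a s \<noteq> 0" "?b t \<noteq> 0"
      using coeffs[OF f, of s] coeffs[OF g, of t] by auto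
    ultimately show False
      using gauss_mult_mod[OF \<phi>(1-3), of "?a s" "?b t"] degree_expansion_less[OF \<phi>(4)] by auto
  qed
  then have c_nz: "?c (s + t) \<noteq> 0" by (auto simp: polys_over_def)
  have min: "phi_value v \<phi> \<mu> (f * g) (s + t) = \<gamma> + \<delta>"
    using c_ge[of "s + t"] c_st c_nz
    by (auto simp: polys_over_val_ge_iff polys_over_val_gt_iff phi_value_def algebra_simps)
  have gr: "\<gamma> + \<delta> < phi_value v \<phi> \<mu> (f * g) k" if "?c k \<noteq> 0" "k \<noteq> s + t" for k
    using c_gt[of k] that by (auto simp: polys_over_val_gt_iff phi_value_def algebra_simps)
  show ?thesis
  proof (intro equalityI subsetI)
    fix k assume k: "k \<in> supporting_indices v \<phi> \<mu> (f * g)"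
    then have "phi_value v \<phi> \<mu> (f * g) k \<le> \<gamma> + \<delta>"
      using c_nz min by (auto simp: supporting_indices_def)
    then show "k \<in> {s + t}"
      using gr[of k] k leD[of "phi_value v \<phi> \<mu> (f * g) k"]
      by (auto simp: supporting_indices_def)
  next
    fix k assume "k \<in> {s + t}"
    moreover have "\<gamma> + \<delta> \<le> phi_value v \<phi> \<mu> (f * g) j" if "?c j \<noteq> 0" for j
      using gr[OF that] min by (cases "j = s + t") auto
    ultimately show "k \<in> supporting_indices v \<phi> \<mu> (f * g)"
      using c_nz min by (auto simp: supporting_indices_def)
  qed
qed

lemma value_group_diff:
  assumes "p \<noteq> 0" "q \<noteq> 0"
  shows "gauss v p - gauss v q \<in> value_group v"
proof -
  obtain i where i: "Polynomial.coeff p i \<noteq> 0" "gauss v p = v (Polynomial.coeff p i)"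
    using assms(1) by (rule gauss_eq_coeff)
  obtain j where j: "Polynomial.coeff q j \<noteq> 0" "gauss v q = v (Polynomial.coeff q j)"
    using assms(2) by (rule gauss_eq_coeff)
  have "gauss v p - gauss v q = v (Polynomial.coeff p i * inverse (Polynomial.coeff q j))"
    using i j by (simp add: val_mult val_inverse)
  then show ?thesis
    using i j by (auto simp: value_group_def)
qed

lemma supporting_indices_diff:
  assumes "s \<in> supporting_indices v \<phi> \<mu> f" "t \<in> supporting_indices v \<phi> \<mu> f" "s < t"
  shows "nat_mul (t - s) \<mu> \<in> value_group v"
proof -
  have "phi_value v \<phi> \<mu> f s = phi_value v \<phi> \<mu> f t"
    using assms by (intro antisym) (auto simp: supporting_indices_def)
  then have "nat_mul (t - s) \<mu> = gauss v (expansion \<phi> f s) - gauss v (expansion \<phi> f t)"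
    using nat_mul_add_left[of s "t - s" \<mu>] assms(3) by (simp add: phi_value_def algebra_simps)
  then show ?thesis
    using assms value_group_diff by (simp add: supporting_indices_def)
qed

text \<open>
  One of the two factors has two supporting indices.  The distance between them is at least \<open>d\<close>, and the
  larger one bounds the degree of that factor from below.
\<close>

lemma factor_degree_ge:
  assumes \<phi>: "\<phi> \<in> integral_polys v" "Polynomial.lead_coeff \<phi> = 1" "irreducible_mod v \<phi>"
      "Polynomial.degree \<phi> > 0"
    and lam: "0 < \<mu>"
    and st: "s \<in> supporting_indices v \<phi> \<mu> (f * g)" "t \<in> supporting_indices v \<phi> \<mu> (f * g)" "s < t"
    and d: "\<And>n. 0 < n \<Longrightarrow> nat_mul n \<mu> \<in> value_group v \<Longrightarrow> d \<le> n"
  shows "d * Polynomial.degree \<phi> \<le> max (Polynomial.degree f) (Polynomial.degree g)"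
proof -
  have deg: "d * Polynomial.degree \<phi> \<le> Polynomial.degree h"
    if i: "i \<in> supporting_indices v \<phi> \<mu> h" "j \<in> supporting_indices v \<phi> \<mu> h" "i < j" for h i j
  proof -
    have "d \<le> j - i"
      using supporting_indices_diff[OF i] i(3) by (intro d) auto
    then have "d * Polynomial.degree \<phi> \<le> j * Polynomial.degree \<phi>"
      by (intro mult_right_mono) auto
    also have "\<dots> \<le> Polynomial.degree h"
      using \<phi>(4) i by (intro expansion_nonzero_degree_le) (auto simp: supporting_indices_def)
    finally show ?thesis .
  qed
  have sing: "d * Polynomial.degree \<phi> \<le> Polynomial.degree h \<or> (\<exists>i. supporting_indices v \<phi> \<mu> h = {i})"
    if hnz: "h \<noteq> 0" for h
  proof -
    obtain i where i: "i \<in> supporting_indices v \<phi> \<mu> h"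
      using supporting_indices_nonempty[OF \<phi>(4) hnz] by blast
    show ?thesis
    proof (cases "supporting_indices v \<phi> \<mu> h = {i}")
      case False
      then obtain j where "j \<in> supporting_indices v \<phi> \<mu> h" "j \<noteq> i" using i by blast
      then show ?thesis using deg[of i h j] deg[of j h i] i by (auto simp: neq_iff)
    qed blast
  qed
  have exp_0: "expansion \<phi> 0 i = 0" for i
    using expansion_nonzero_degree_le[OF \<phi>(4), of 0 i] is_expansion_coeff[OF is_expansion_expansion[OF \<phi>(4)] \<phi>(4), of 0 i]
    by simp
  have "f * g \<noteq> 0"
    using st(1) exp_0 by (auto simp: supporting_indices_def)
  moreover have "\<not> (\<exists>i. supporting_indices v \<phi> \<mu> (f * g) = {i})"
    using st by auto
  ultimately show ?thesis
    using sing[of f] sing[of g] supporting_indices_mult_singleton[OF \<phi> lam, of f _ g]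
    by (auto simp: le_max_iff_disj)
qed

end

section \<open>Edges of the Newton polygon\<close>

lemma of_group_diff: "of_group (x - y) = of_group x - of_group y"
  using of_group_add[of "x - y" y] by (simp add: algebra_simps)

lemma nat_mul_slope: "i < j \<Longrightarrow> nat_mul (j - i) (slope y i j) = of_group (y j) - of_group (y i)"
  by (simp add: slope_def nat_mul_group_frac_cancel of_group_diff)

text \<open>
  The quantity \<open>y i - i x\<close> is the height at which the line of slope \<open>x\<close> through the point \<open>(i, y i)\<close> meets
  the vertical axis.  Comparing a slope with \<open>x\<close> amounts to comparing two such heights.
\<close>

lemma slope_iff:
  assumes "i < j"
  shows le_slope_iff: "x \<le> slope y i j \<longleftrightarrow> of_group (y i) - nat_mul i x \<le> of_group (y j) - nat_mul j x"
    and slope_le_iff: "slope y i j \<le> x \<longleftrightarrow> of_group (y j) - nat_mul j x \<le> of_group (y i) - nat_mul i x"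
proof -
  have *: "nat_mul j x = nat_mul i x + nat_mul (j - i) x"
    using nat_mul_add_left[of i "j - i" x] assms by simp
  have "x \<le> slope y i j \<longleftrightarrow> nat_mul (j - i) x \<le> of_group (y j) - of_group (y i)"
    using nat_mul_le_iff[of "j - i" x "slope y i j"] assms by (simp add: nat_mul_slope)
  then show "x \<le> slope y i j \<longleftrightarrow> of_group (y i) - nat_mul i x \<le> of_group (y j) - nat_mul j x"
    by (auto simp: * algebra_simps)
  have "slope y i j \<le> x \<longleftrightarrow> of_group (y j) - of_group (y i) \<le> nat_mul (j - i) x"
    using nat_mul_le_iff[of "j - i" "slope y i j" x] assms by (simp add: nat_mul_slope)
  then show "slope y i j \<le> x \<longleftrightarrow> of_group (y j) - nat_mul j x \<le> of_group (y i) - nat_mul i x"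
    by (auto simp: * algebra_simps)
qed

lemma slope_line:
  "i < j \<Longrightarrow> of_group (y i) - nat_mul i (slope y i j) = of_group (y j) - nat_mul j (slope y i j)"
proof -
  assume "i < j"
  then show ?thesis
    using nat_mul_slope[of i j y] nat_mul_add_left[of i "j - i" "slope y i j"] by (simp add: algebra_simps)
qed

lemma next_vertex_slope:
  assumes "finite S" "k \<in> S" "i < k"
  shows "slope y i (next_vertex S y i) \<le> slope y i k"
proof -
  let ?A = "{slope y i k | k. k \<in> S \<and> i < k}"
  let ?J = "{j \<in> S. i < j \<and> slope y i j = Min ?A}"
  have fin: "finite ?A" using assms(1) by simp
  have "Min ?A \<in> ?A"
    using assms by (intro Min_in) auto
  then have "?J \<noteq> {}" by force
  then have "Max ?J \<in> ?J"
    using assms(1) by (intro Max_in) auto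
  then have "slope y i (next_vertex S y i) = Min ?A"
    by (simp add: next_vertex_def)
  then show ?thesis using fin assms by (auto intro: Min_le)
qed

text \<open>
  Each edge spans a line below all points.  The invariant is convexity at the current vertex \<open>i\<close>: no
  slope from \<open>i\<close> to a point on its right is less than a slope from a point on its left to \<open>i\<close>.  It
  places the points on the left of \<open>i\<close> above the next edge, the minimality in the choice of the next
  vertex places those on the right, and both together give convexity at that vertex.
\<close>

lemma slopes_from_supporting:
  assumes "x \<in> set (slopes_from S y i)" "i \<in> S"
    and "\<And>j k. j \<in> S \<Longrightarrow> i < j \<Longrightarrow> k \<in> S \<Longrightarrow> k < i \<Longrightarrow> slope y k i \<le> slope y i j"
  shows "\<exists>p\<in>S. \<exists>q\<in>S. p < q \<and> slope y p q = x \<and>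
    (\<forall>k\<in>S. of_group (y p) - nat_mul p x \<le> of_group (y k) - nat_mul k x)"
  using assms
proof (induction S y i rule: slopes_from.induct)
  case (1 S y i)
  have S: "finite S" "\<exists>j\<in>S. i < j"
    using "1.prems"(1) by (auto simp: slopes_from.simps[of S y i] split: if_splits)
  define n where "n = next_vertex S y i"
  have n: "n \<in> S" "i < n"
    unfolding n_def using S by (auto intro: next_vertex_in)
  have line: "of_group (y i) - nat_mul i (slope y i n) \<le> of_group (y k) - nat_mul k (slope y i n)"
    if k: "k \<in> S" for k
  proof (cases k i rule: linorder_cases)
    case less
    then have "slope y k i \<le> slope y i n" using "1.prems"(3) n k by blast
    then show ?thesis using less by (simp add: slope_le_iff)
  next
    case greater
    then show ?thesis
      using next_vertex_slope[OF S(1) k greater, of y] by (simp add: le_slope_iff n_def)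
  qed simp
  consider "x = slope y i n" | "x \<in> set (slopes_from S y n)"
    using "1.prems"(1) S by (auto simp: slopes_from.simps[of S y i] n_def)
  then show ?case
  proof cases
    case 1
    then show ?thesis using line n "1.prems"(2) by blast
  next
    case 2
    show ?thesis
    proof (rule "1.IH"[folded n_def])
      show "finite S \<and> (\<exists>j\<in>S. i < j)" using S by blast
      show "x \<in> set (slopes_from S y n)" by (rule 2)
      show "n \<in> S" by (rule n)
      fix j k assume j: "j \<in> S" "n < j" and k: "k \<in> S" "k < n"
      let ?x = "slope y i n"
      have "of_group (y n) - nat_mul n ?x \<le> of_group (y k) - nat_mul k ?x"
        using line[OF k(1)] slope_line[OF n(2), of y] by simp
      then have "slope y k n \<le> ?x"
        using k(2) by (simp add: slope_le_iff)
      also have "?x \<le> slope y n j"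
        using line[OF j(1)] slope_line[OF n(2), of y] j(2) by (simp add: le_slope_iff)
      finally show "slope y k n \<le> slope y n j" .
    qed
  qed
qed


section \<open>Passage to the divisible closure and the degree bound\<close>

text \<open>
  Slopes lie in the divisible closure, which need not be the group of values.  The results on supporting
  indices are therefore applied to \<open>of_group \<circ> v\<close>, a valuation that has the same valuation ring and
  maximal ideal as \<open>v\<close>.
\<close>

lemma of_group_zero [simp]: "of_group 0 = 0"
  by (simp add: of_group_def group_frac_zero)

lemma krull_valuation_of_group:
  assumes "krull_valuation v"
  shows "krull_valuation (of_group \<circ> v)"
  using assms unfolding krull_valuation_def
  by (auto simp: of_group_add of_group_le_iff min_le_iff_disj)

lemma irreducible_mod_of_group: "irreducible_mod (of_group \<circ> v) \<phi> \<longleftrightarrow> irreducible_mod v \<phi>"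
  and integral_polys_of_group: "integral_polys (of_group \<circ> v) = integral_polys v"
proof -
  have "valuation_ring_set (of_group \<circ> v) = valuation_ring_set v"
    using of_group_le_iff[of 0] by (auto simp: valuation_ring_set_def)
  moreover have "maximal_ideal (of_group \<circ> v) = maximal_ideal v"
    using of_group_le_iff[of _ 0] by (auto simp: maximal_ideal_def not_le[symmetric])
  ultimately show "irreducible_mod (of_group \<circ> v) \<phi> \<longleftrightarrow> irreducible_mod v \<phi>"
      "integral_polys (of_group \<circ> v) = integral_polys v"
    by (simp_all add: irreducible_mod_def reduce_poly_def residue_field_def valuation_ring_def
        integral_polys_def)
qed

lemma gauss_of_group:
  assumes "krull_valuation v" "p \<noteq> 0"
  shows "gauss (of_group \<circ> v) p = of_group (gauss v p)"
proof -
  interpret v: krull_valued v by unfold_locales (rule assms)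
  interpret w: krull_valued "of_group \<circ> v"
    by unfold_locales (rule krull_valuation_of_group[OF assms(1)])
  obtain i where i: "Polynomial.coeff p i \<noteq> 0" "gauss v p = v (Polynomial.coeff p i)"
    using assms(2) by (rule v.gauss_eq_coeff)
  obtain j where j: "Polynomial.coeff p j \<noteq> 0"
      "gauss (of_group \<circ> v) p = (of_group \<circ> v) (Polynomial.coeff p j)"
    using assms(2) by (rule w.gauss_eq_coeff)
  show ?thesis
    using w.gauss_le_coeff[OF i(1)] v.gauss_le_coeff[OF j(1)] i(2) j(2)
    by (intro antisym) (auto simp: of_group_le_iff)
qed

text \<open>
  The point with abscissa \<open>k\<close> belongs to the coefficient of \<open>\<phi>\<^sup>n\<^sup>-\<^sup>k\<close>.  The value of that term is \<open>n x\<close> more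
  than the height \<open>y k - k x\<close>, so the points on the supporting line are exactly the terms of least value.
\<close>

lemma newton_slope_supporting:
  assumes v: "krull_valuation v" and \<phi>: "Polynomial.degree \<phi> > 0" and f: "f \<noteq> 0"
    and x: "x \<in> set (newton_slopes v \<phi> f)"
  obtains s t where "s \<in> supporting_indices (of_group \<circ> v) \<phi> x f"
    "t \<in> supporting_indices (of_group \<circ> v) \<phi> x f" "s < t"
proof -
  let ?a = "expansion \<phi> f"
  define n where "n = expansion_length \<phi> f"
  define S where "S = {i. i \<le> n \<and> ?a (n - i) \<noteq> 0}"
  define y where "y = (\<lambda>i. gauss v (?a (n - i)))"
  have n: "?a n \<noteq> 0" "\<And>j. ?a j \<noteq> 0 \<Longrightarrow> j \<le> n"
    using Max_in[OF finite_expansion_support[OF \<phi>] expansion_support_nonempty[OF \<phi> f]]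
      Max_ge[OF finite_expansion_support[OF \<phi>, of f]]
    by (auto simp: n_def expansion_length_def)
  have "x \<in> set (slopes_from S y 0)"
    using x by (simp add: newton_slopes_def Let_def S_def y_def n_def)
  moreover have "0 \<in> S" using n by (simp add: S_def)
  ultimately obtain p q where pq: "p \<in> S" "q \<in> S" "p < q" "slope y p q = x"
      "\<And>k. k \<in> S \<Longrightarrow> of_group (y p) - nat_mul p x \<le> of_group (y k) - nat_mul k x"
    using slopes_from_supporting[of x S y 0] by auto
  have val: "phi_value (of_group \<circ> v) \<phi> x f (n - k) = of_group (y k) - nat_mul k x + nat_mul n x"
    if "k \<in> S" for k
    using that nat_mul_add_left[of k "n - k" x]
    by (simp add: S_def y_def phi_value_def gauss_of_group[OF v] algebra_simps)
  have supp: "n - k \<in> supporting_indices (of_group \<circ> v) \<phi> x f"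
    if k: "k \<in> S" "of_group (y k) - nat_mul k x = of_group (y p) - nat_mul p x" for k
    unfolding supporting_indices_def
  proof (intro CollectI conjI allI impI)
    show "?a (n - k) \<noteq> 0" using k by (simp add: S_def)
    fix j assume "?a j \<noteq> 0"
    then have j: "n - (n - j) = j" "n - j \<in> S" using n(2)[of j] by (auto simp: S_def)
    show "phi_value (of_group \<circ> v) \<phi> x f (n - k) \<le> phi_value (of_group \<circ> v) \<phi> x f j"
      using val[OF k(1)] val[OF j(2)] pq(5)[OF j(2)] k(2) j(1) by simp
  qed
  have "of_group (y q) - nat_mul q x = of_group (y p) - nat_mul p x"
    using slope_line[OF pq(3), of y] pq(4) by simp
  then have "n - q \<in> supporting_indices (of_group \<circ> v) \<phi> x f"
    using pq by (intro supp) auto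
  moreover have "n - p \<in> supporting_indices (of_group \<circ> v) \<phi> x f"
    using pq by (intro supp) auto
  moreover have "n - q < n - p" using pq by (auto simp: S_def)
  ultimately show ?thesis using that by blast
qed

lemma slope_denominator_le:
  assumes "0 < n" "nat_mul n x \<in> value_group (of_group \<circ> v)"
  shows "slope_denominator v x \<le> n"
proof -
  have "value_group (of_group \<circ> v) = of_group ` value_group v"
    by (auto simp: value_group_def)
  then show ?thesis
    unfolding slope_denominator_def using assms by (intro Least_le) auto
qed

theorem corollary1p4:
  fixes v :: "'a::field \<Rightarrow> 'g::linordered_ab_group_add"
    and \<phi> f f1 f2 :: "'a poly"
    and m l :: nat
    and lam :: "nat \<Rightarrow> 'g div_closure"
    and d :: "nat \<Rightarrow> nat"
  assumes "krull_valuation v"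
    and "\<phi> \<in> integral_polys v"
    and "Polynomial.lead_coeff \<phi> = 1"
    and "Polynomial.degree \<phi> = m"
    and "irreducible_mod v \<phi>"
    and "f \<in> integral_polys v"
    and "\<not> \<phi> dvd f"
    and "length (positive_slopes v \<phi> f) = l"
    and "l \<ge> 1"
    and "\<And>j. j \<in> {1..l} \<Longrightarrow> lam j = positive_slopes v \<phi> f ! (j - 1)"
    and "\<And>j. j \<in> {1..l} \<Longrightarrow> d j = slope_denominator v (lam j)"
    and "f = f1 * f2"
  shows "int (min (Polynomial.degree f1) (Polynomial.degree f2))
           \<le> int (Polynomial.degree f) - int (Max {d j * m | j. j \<in> {1..l}})"
proof -
  interpret w: krull_valued "of_group \<circ> v"
    by unfold_locales (rule krull_valuation_of_group[OF assms(1)])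
  have "f \<noteq> 0" using assms(7) by auto
  have "Polynomial.degree \<phi> > 0"
  proof (rule ccontr)
    assume "\<not> ?thesis"
    (* A constant monic polynomial divides everything, contrary to the hypothesis on f. *)
    then have "\<phi> = 1"
      using assms(3) by (auto simp: one_pCons elim!: degree_eq_zeroE)
    then show False using assms(7) by simp
  qed
  have "Max {d j * m | j. j \<in> {1..l}} \<in> {d j * m | j. j \<in> {1..l}}"
    using assms(9) by (intro Max_in) auto
  then obtain j where j: "j \<in> {1..l}" "Max {d j * m | j. j \<in> {1..l}} = d j * m"
    by blast
  have "lam j \<in> set (positive_slopes v \<phi> f)"
    using assms(8,10) j(1) by auto
  then have lam: "lam j \<in> set (newton_slopes v \<phi> f)" "0 < lam j"
    by (auto simp: positive_slopes_def)
  obtain s t where "s \<in> supporting_indices (of_group \<circ> v) \<phi> (lam j) (f1 * f2)"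
      "t \<in> supporting_indices (of_group \<circ> v) \<phi> (lam j) (f1 * f2)" "s < t"
    using newton_slope_supporting[OF assms(1) \<open>Polynomial.degree \<phi> > 0\<close> \<open>f \<noteq> 0\<close> lam(1)]
    unfolding assms(12) by blast
  then have "slope_denominator v (lam j) * Polynomial.degree \<phi>
      \<le> max (Polynomial.degree f1) (Polynomial.degree f2)"
    using assms(2,3,5) \<open>Polynomial.degree \<phi> > 0\<close> lam(2)
    by (intro w.factor_degree_ge[of \<phi> "lam j" s _ _ t])
      (auto simp: integral_polys_of_group irreducible_mod_of_group intro: slope_denominator_le)
  then have "d j * m \<le> max (Polynomial.degree f1) (Polynomial.degree f2)"
    using assms(4,11) j(1) by simp
  moreover have "Polynomial.degree f = Polynomial.degree f1 + Polynomial.degree f2"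
    using \<open>f \<noteq> 0\<close> assms(12) by (auto simp: degree_mult_eq)
  ultimately show ?thesis unfolding j(2) by linarith
qed

end
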